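(* Let $\{x_t\},\{\bar x_t\},\{w_t\},\{y_t\}$ be generated by the AC-ADMM iteration (defined in the context) with $\mu_d>0$, $\eta_1>0$, $\beta_1=0$, $\beta_t=\beta$ for $t\ge2$ with $\beta\in(0,1-\frac{\sqrt6}{3}]$, $\tau_1=0$, $\tau_2=\mu_d$, $\eta_2=\min\{(1-\beta)\eta_1,\frac{\mu_d}{4L_{K,1}^2}\}$, and for $t\ge3$ $$\eta_t=\min\Big\{\tfrac43\eta_{t-1},\ \frac{\tau_{t-2}+\mu_d}{\tau_{t-1}}\eta_{t-1},\ \frac{\tau_{t-1}}{4L_{K,t-1}^2}\Big\},\qquad\tau_t=\tau_{t-1}+\frac{\mu_d}{2}\Big[\alpha+(1-\alpha)\eta_t\cdot\frac{4L_{K,t-1}^2}{\tau_{t-1}}\Big]$$ for some absolute constant $\alpha\in(0,1]$. Then for all $t\ge2$, $$\eta_t\ge\frac{(3+\alpha(t-3))\mu_d}{12\widehat L_{K,t-1}^2},\qquad\text{where }\widehat L_{K,t}:=\max\Big\{\sqrt{\tfrac{\mu_d}{4(1-\beta)\eta_1}},L_{K,1},\dots,L_{K,t}\Big\}.$$ Consequently, with $\widehat x_k=\frac{\sum_{t=1}^k\eta_{t+1}x_t}{\sum_{t=1}^k\eta_{t+1}}$ and $\widehat w_k=\frac{\sum_{t=1}^k\eta_{t+1}w_t}{\sum_{t=1}^k\eta_{t+1}}$, for every $k\ge1$, $$F(\widehat x_k)+G(\widehat w_k)-F(x^* )-G(w^* )\le\frac{12\widehat L_{K,k}^2}{\mu_d(6k+\alpha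 k(k-3))}\Big[\frac{\|x_0-x^*\|^2}{\beta}+\eta_2\Big(\frac{5L_{K,1}^2}{2\mu_d}-\frac1{2\eta_1}\Big)\|x_1-x_0\|^2\Big],$$ $$\|K\widehat x_k-B\widehat w_k+b\|\le2\mu_d\|y^*\|+2\sqrt{\frac{12\widehat L_{K,k}^2}{6k+\alpha k(k-3)}\Big[\frac{\|x_0-x^*\|^2}{\beta}+\eta_2\Big(\frac{5L_{K,1}^2}{2\mu_d}-\frac1{2\eta_1}\Big)\|x_1-x_0\|^2\Big]}.$$
   Context: Setting: $X\subseteq\mathbb{R}^{n_1}$ and $W\subseteq\mathbb{R}^{n_2}$ are nonempty closed convex sets, $b\in\mathbb{R}^m$, $K\in\mathbb{R}^{m\times n_1}$, $B\in\mathbb{R}^{m\times n_2}$, and $F:X\to\mathbb{R}$, $G:W\to\mathbb{R}$ are proper, lower semicontinuous, convex. Norms are Euclidean. The problem is $\min_{x\in X,w\in W}\{F(x)+G(w):Bw-Kx=b\}$. It is assumed that it has an optimal solution $(x^*,w^* )\in X\times W$ together with $y^*\in\mathbb{R}^m$ such that $(x^*,w^*,y^* )$ is a saddle point of $\min_{x\in X,w\in W}\max_{y\in\mathbb{R}^m}F(x)+G(w)+\langle Kx-Bw+b,y\rangle$. AC-ADMM iteration: given $x_0=\bar x_0\in X$, $\mu_d>0$ and parameters $\beta_t\in[0,1)$, $\eta_t$, $\tau_t$, let $w_0\in\arg\min_{w\in W}\{G(w)+\frac1{2\mu_d}\|Bw-Kx_0-b\|^2\}$, $y_0=(Kx_0-Bw_0+b)/\mu_d$,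 and for $t=1,2,\dots$ - $x_t=\arg\min_{x\in X}\{\eta_t[\langle K^\top y_{t-1},x\rangle+F(x)]+\frac12\|\bar x_{t-1}-x\|^2\}$, - $\bar x_t=(1-\beta_t)\bar x_{t-1}+\beta_tx_t$, - $w_t\in\arg\min_{w\in W}\{G(w)+(\tau_t+\mu_d)^{-1}(-\tau_t\langle y_{t-1},Bw\rangle+\frac12\|Bw-Kx_t-b\|^2)\}$, - $y_t=[\tau_ty_{t-1}-(Bw_t-Kx_t-b)]/(\tau_t+\mu_d)$. The minimizers defining $w_t$ are assumed to exist. Local norm estimates: $L_{K,t}=\|K^\top(y_t-y_{t-1})\|/\|y_t-y_{t-1}\|$ for $t\ge1$. Conventions: $0/0=0$ and $a/0=+\infty$ for $a>0$.
   Formalization: In both rate estimates the bracket [‖x_0−x*‖²/β+η_2(5L_{K,1}²/(2μ_d)−1/(2η_1))‖x_1−x_0‖²] is replaced by its maximum with 0, since it can be negative, and then the square root is undefined and the printed objective bound can fail. *)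

theory Defs
  imports "HOL-Analysis.Analysis"
begin

text \<open>
  Lower semicontinuity of a real-valued \<open>f\<close> relative to its domain \<open>X\<close>.  For closed \<open>X\<close> this is
  lower semicontinuity of the extension of \<open>f\<close> by \<open>+\<infinity>\<close> outside \<open>X\<close>.  A real-valued function on a
  nonempty set is automatically proper, so no separate notion of properness is needed.
\<close>

definition lsc_on :: "'a::topological_space set \<Rightarrow> ('a \<Rightarrow> real) \<Rightarrow> bool" where
  "lsc_on X f \<longleftrightarrow> (\<forall>x\<in>X. \<forall>c<f x. \<forall>\<^sub>F z in at x within X. c < f z)"

abbreviation argmin_on :: "('a \<Rightarrow> real) \<Rightarrow> 'a set \<Rightarrow> 'a \<Rightarrow> bool" where
  "argmin_on f S x \<equiv> is_arg_min f (\<lambda>z. z \<in> S) x"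

definition lagrangian ::
  "(real^'n \<Rightarrow> real) \<Rightarrow> (real^'p \<Rightarrow> real) \<Rightarrow> real^'n^'m \<Rightarrow> real^'p^'m \<Rightarrow> real^'m
    \<Rightarrow> real^'n \<Rightarrow> real^'p \<Rightarrow> real^'m \<Rightarrow> real" where
  "lagrangian F G K B b x w y = F x + G w + (K *v x - B *v w + b) \<bullet> y"

definition optimal_solution ::
  "(real^'n) set \<Rightarrow> (real^'p) set \<Rightarrow> (real^'n \<Rightarrow> real) \<Rightarrow> (real^'p \<Rightarrow> real)
    \<Rightarrow> real^'n^'m \<Rightarrow> real^'p^'m \<Rightarrow> real^'m \<Rightarrow> real^'n \<Rightarrow> real^'p \<Rightarrow> bool" where
  "optimal_solution X W F G K B b xs ws \<longleftrightarrow>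
     argmin_on (\<lambda>(x, w). F x + G w) {(x, w). x \<in> X \<and> w \<in> W \<and> B *v w - K *v x = b} (xs, ws)"

definition saddle_point ::
  "(real^'n) set \<Rightarrow> (real^'p) set \<Rightarrow> (real^'n \<Rightarrow> real) \<Rightarrow> (real^'p \<Rightarrow> real)
    \<Rightarrow> real^'n^'m \<Rightarrow> real^'p^'m \<Rightarrow> real^'m \<Rightarrow> real^'n \<Rightarrow> real^'p \<Rightarrow> real^'m \<Rightarrow> bool" where
  "saddle_point X W F G K B b xs ws ys \<longleftrightarrow> xs \<in> X \<and> ws \<in> W \<and>
     (\<forall>y. lagrangian F G K B b xs ws y \<le> lagrangian F G K B b xs ws ys) \<and>
     (\<forall>x\<in>X. \<forall>w\<in>W. lagrangian F G K B b xs ws ys \<le> lagrangian F G K B b x w ys)"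

text \<open>
  The AC-ADMM iteration as a relation between the parameter sequences \<open>bs\<close> (averaging), \<open>\<eta>\<close>, \<open>\<tau>\<close>
  and the sequences \<open>x\<close>, \<open>xb\<close> (averaged), \<open>w\<close>, \<open>y\<close>.  It is a relation and not a recursive
  function because the parameters may depend on earlier iterates and because \<open>w t\<close> is an arbitrary
  minimizer.
\<close>

definition ac_admm ::
  "(real^'n) set \<Rightarrow> (real^'p) set \<Rightarrow> (real^'n \<Rightarrow> real) \<Rightarrow> (real^'p \<Rightarrow> real)
    \<Rightarrow> real^'n^'m \<Rightarrow> real^'p^'m \<Rightarrow> real^'m
    \<Rightarrow> real \<Rightarrow> (nat \<Rightarrow> real) \<Rightarrow> (nat \<Rightarrow> real) \<Rightarrow> (nat \<Rightarrow> real)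
    \<Rightarrow> (nat \<Rightarrow> real^'n) \<Rightarrow> (nat \<Rightarrow> real^'n) \<Rightarrow> (nat \<Rightarrow> real^'p) \<Rightarrow> (nat \<Rightarrow> real^'m) \<Rightarrow> bool" where
  "ac_admm X W F G K B b \<mu> bs \<eta> \<tau> x xb w y \<longleftrightarrow>
     x 0 \<in> X \<and> xb 0 = x 0 \<and>
     argmin_on (\<lambda>v. G v + 1 / (2 * \<mu>) * (norm (B *v v - K *v x 0 - b))\<^sup>2) W (w 0) \<and>
     y 0 = (K *v x 0 - B *v w 0 + b) /\<^sub>R \<mu> \<and>
     (\<forall>t\<ge>1.
        0 \<le> bs t \<and> bs t < 1 \<and>
        argmin_on (\<lambda>u. \<eta> t * ((transpose K *v y (t - 1)) \<bullet> u + F u)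
                        + 1 / 2 * (norm (xb (t - 1) - u))\<^sup>2) X (x t) \<and>
        xb t = (1 - bs t) *\<^sub>R xb (t - 1) + bs t *\<^sub>R x t \<and>
        argmin_on (\<lambda>v. G v + 1 / (\<tau> t + \<mu>) * (- \<tau> t * (y (t - 1) \<bullet> (B *v v))
                        + 1 / 2 * (norm (B *v v - K *v x t - b))\<^sup>2)) W (w t) \<and>
        y t = (\<tau> t *\<^sub>R y (t - 1) - (B *v w t - K *v x t - b)) /\<^sub>R (\<tau> t + \<mu>))"

text \<open>
  If \<open>y t = y (t - 1)\<close>, the value is \<open>0 / 0 = 0\<close>.
\<close>

definition local_norm :: "real^'n^'m \<Rightarrow> (nat \<Rightarrow> real^'m) \<Rightarrow> nat \<Rightarrow> real" where
  "local_norm K y t = norm (transpose K *v (y t - y (t - 1))) / norm (y t - y (t - 1))"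

definition L_hat :: "real \<Rightarrow> real \<Rightarrow> real \<Rightarrow> (nat \<Rightarrow> real) \<Rightarrow> nat \<Rightarrow> real" where
  "L_hat \<mu> \<beta> \<eta>1 L t = Max (insert (sqrt (\<mu> / (4 * (1 - \<beta>) * \<eta>1))) (L ` {1..t}))"

text \<open>
  The step size rule.  The minima are taken in the extended reals, where \<open>a / 0 = \<infinity>\<close> for \<open>a > 0\<close>:
  a term whose local norm estimate vanishes imposes no restriction.  (In \<open>real\<close>, \<open>a / 0 = 0\<close> would
  make the step size vanish.)
\<close>

definition step_size_rule ::
  "real \<Rightarrow> real \<Rightarrow> real \<Rightarrow> (nat \<Rightarrow> real) \<Rightarrow> (nat \<Rightarrow> real) \<Rightarrow> (nat \<Rightarrow> real) \<Rightarrow> (nat \<Rightarrow> real) \<Rightarrow> bool" where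
  "step_size_rule \<mu> \<alpha> \<beta> L bs \<eta> \<tau> \<longleftrightarrow>
     \<eta> 1 > 0 \<and> bs 1 = 0 \<and> (\<forall>t\<ge>2. bs t = \<beta>) \<and> \<tau> 1 = 0 \<and> \<tau> 2 = \<mu> \<and>
     ereal (\<eta> 2) = min (ereal ((1 - \<beta>) * \<eta> 1)) (ereal \<mu> / ereal (4 * (L 1)\<^sup>2)) \<and>
     (\<forall>t\<ge>3.
        ereal (\<eta> t) = min (ereal (4 / 3 * \<eta> (t - 1)))
                      (min (ereal ((\<tau> (t - 2) + \<mu>) / \<tau> (t - 1) * \<eta> (t - 1)))
                           (ereal (\<tau> (t - 1)) / ereal (4 * (L (t - 1))\<^sup>2))) \<and>
        \<tau> t = \<tau> (t - 1)
               + \<mu> / 2 * (\<alpha> + (1 - \<alpha>) * \<eta> t * (4 * (L (t - 1))\<^sup>2 / \<tau> (t - 1))))"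

definition ergodic_avg :: "(nat \<Rightarrow> real) \<Rightarrow> (nat \<Rightarrow> 'a::real_vector) \<Rightarrow> nat \<Rightarrow> 'a" where
  "ergodic_avg \<eta> x k = (\<Sum>t=1..k. \<eta> (t + 1) *\<^sub>R x t) /\<^sub>R (\<Sum>t=1..k. \<eta> (t + 1))"

text \<open>
  The bracket on the right-hand side of the rate estimates, with \<open>L1\<close> the first local norm estimate.
  Its second summand can be negative and outweigh the first (for instance if \<open>x0 = xs\<close> and \<open>\<eta>1\<close> is
  small); the square root of the feasibility estimate is then undefined as a real number, and dividing
  by the lower bound for the sum of the step sizes goes in the wrong direction in the estimate of the
  objective.  The rate estimates are therefore stated with \<open>max 0\<close> of this expression, which is the
  expression itself whenever it is nonnegative.
\<close>

definition rate_const ::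
  "real \<Rightarrow> real \<Rightarrow> real \<Rightarrow> real \<Rightarrow> real \<Rightarrow> 'a::real_normed_vector \<Rightarrow> 'a \<Rightarrow> 'a \<Rightarrow> real" where
  "rate_const \<mu> \<beta> \<eta>1 \<eta>2 L1 xs x0 x1 =
     (norm (x0 - xs))\<^sup>2 / \<beta> + \<eta>2 * (5 * L1\<^sup>2 / (2 * \<mu>) - 1 / (2 * \<eta>1)) * (norm (x1 - x0))\<^sup>2"

end

theory Submission
  imports Defs
begin

text \<open>
  At each step the pair \<open>(w t, y t)\<close> is the optimality system of the auxiliary minimization: \<open>w t\<close>
  minimizes \<open>G v - y t \<bullet> (B *v v)\<close>, and \<open>\<mu> *\<^sub>R y t + \<tau> t *\<^sub>R (y t - y (t - 1))\<close> is the constraint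
  residual.  The method is therefore a primal-dual method for the saddle point problem perturbed by
  \<open>- \<mu> / 2 * (norm y)\<^sup>2\<close>, with a proximal term of weight \<open>\<tau> t\<close> in the dual variable and a prox center
  \<open>xb\<close> that lags behind the primal iterates.

  The central estimate (\<open>gap_step\<close>) bounds the primal-dual gap at \<open>(x t, w t)\<close> with weight
  \<open>\<eta> (t + 1)\<close>.  The optimality condition of \<open>x (t + 1)\<close> is compared with the solution, and the one of
  \<open>x t\<close> is compared with \<open>x (t + 1)\<close>; their combination replaces the stale multiplier in the linear term
  and leaves a single cross term between \<open>y t - y (t - 1)\<close> and \<open>x (t + 1) - x t\<close>.  Only the local
  quotient \<open>local_norm K y t\<close> is needed to bound that term, and the step size rule makes the bound small
  enough to be absorbed by two negative squares: the dual one of weight \<open>\<tau> t\<close>, and the primal ones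
  that come from the lagging center.  The condition on \<open>\<beta>\<close> says that the growth factor \<open>4 / 3\<close> of the
  step sizes is at most \<open>2 * (1 - \<beta>)\<^sup>2\<close>, so that a quarter of a square remains to be passed on to the
  next step.  The distances from \<open>xb\<close> to the solution telescope, as do the dual distances, because
  \<open>\<eta> (t + 1) * \<tau> t \<le> \<eta> t * (\<tau> (t - 1) + \<mu>)\<close>.  The first step has no dual proximal term; there
  \<open>first_dual_increment\<close> bounds the change of \<open>y\<close> by the change of \<open>x\<close>, which produces the second
  summand of \<open>rate_const\<close>.

  Summing and averaging bounds \<open>objective + residual \<bullet> v - \<mu> / 2 * (norm v)\<^sup>2\<close> at the ergodic averages,
  for every multiplier \<open>v\<close>.  The choice \<open>v = 0\<close> gives the estimate of the objective.  Choosing \<open>v\<close> as the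
  residual divided by \<open>\<mu>\<close>, and using the saddle point property to bound the objective from below,
  gives a quadratic inequality for the norm of the residual.  The rates follow from the linear growth
  of the step sizes (\<open>\<eta>_lower_bound\<close>), an induction over the three terms of the step size rule.
\<close>

section \<open>Inner product inequalities\<close>

text \<open>
  Compare the minimizer with the points at parameter \<open>l\<close> on the segment to \<open>z\<close>.  Convexity makes the
  change of \<open>f\<close> at most linear in \<open>l\<close>, the second-order term of \<open>q\<close> vanishes after division by \<open>l\<close>,
  and the slope \<open>a\<close> of \<open>q\<close> remains.
\<close>

lemma argmin_first_order:
  fixes f q :: "'a::real_vector \<Rightarrow> real"
  assumes conv: "convex_on S f" and min: "argmin_on (\<lambda>z. f z + q z) S x" and z: "z \<in> S"
    and q: "\<And>l. 0 < l \<Longrightarrow> l \<le> 1 \<Longrightarrow> q ((1 - l) *\<^sub>R x + l *\<^sub>R z) \<le> q x + l * a + l\<^sup>2 * c"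
  shows "f x \<le> f z + a"
proof (rule ccontr)
  assume neg: "\<not> f x \<le> f z + a"
  define d where "d = f x - f z - a"
  have d: "d > 0" using neg by (simp add: d_def)
  \<comment> \<open>so small that the second-order term stays below the assumed defect \<open>d\<close>\<close>
  define l where "l = min 1 (d / (2 * (\<bar>c\<bar> + 1)))"
  have l: "0 < l" "l \<le> 1" "l \<le> d / (2 * (\<bar>c\<bar> + 1))"
    using d by (auto simp: l_def intro!: divide_pos_pos)
  have x: "x \<in> S" and le: "\<And>u. u \<in> S \<Longrightarrow> f x + q x \<le> f u + q u"
    using min by (auto simp: is_arg_min_def not_less)
  have "l * \<bar>c\<bar> \<le> l * (\<bar>c\<bar> + 1)" using l(1) by simp
  also have "\<dots> \<le> d / 2" using l(3) by (simp add: field_simps)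
  finally have lc: "l * c < d"
    using l(1) d by (smt (verit) abs_ge_self mult_left_mono field_sum_of_halves)
  define u where "u = (1 - l) *\<^sub>R x + l *\<^sub>R z"
  have u: "u \<in> S"
    using convexD_alt[OF convex_on_imp_convex[OF conv] x z, of l] l by (simp add: u_def)
  have "f u \<le> (1 - l) * f x + l * f z"
    using convex_onD[OF conv _ _ x z, of l] l by (simp add: u_def)
  moreover have "q u \<le> q x + l * a + l\<^sup>2 * c"
    unfolding u_def using q l by blast
  ultimately have "f x + q x \<le> (1 - l) * f x + l * f z + q x + l * a + l\<^sup>2 * c"
    using le[OF u] by linarith
  then have "l * d \<le> l * (l * c)" by (simp add: d_def algebra_simps power2_eq_square)
  with l(1) lc show False by simp
qed

lemma three_point_identity:
  fixes u v w :: "'a::real_inner"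
  shows "(u - v) \<bullet> (v - w) = ((norm (u - w))\<^sup>2 - (norm (v - w))\<^sup>2 - (norm (u - v))\<^sup>2) / 2"
  by (simp add: power2_norm_eq_inner inner_diff_left inner_diff_right inner_commute)

text \<open>
  Rewrites the prox inequality with center \<open>c\<close> in terms of the distances of the old and the new averaged
  center to \<open>u\<close>, which telescope along the iteration.  The price is the factor \<open>1 / \<beta>\<close>; the gain is the
  factor \<open>1 - \<beta> / 2\<close>, instead of \<open>1 / 2\<close>, in front of the negative square.
\<close>

lemma prox_of_averaged_center:
  fixes c c' v u :: "'a::real_inner"
  assumes c': "c' = (1 - \<beta>) *\<^sub>R c + \<beta> *\<^sub>R v" and \<beta>: "\<beta> > 0"
  shows "(c - v) \<bullet> (v - u)
         = ((norm (c - u))\<^sup>2 - (norm (c' - u))\<^sup>2) / (2 * \<beta>) - (1 - \<beta> / 2) * (norm (v - c))\<^sup>2"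
proof -
  define e where "e = c - u"
  define d where "d = v - c"
  have 1: "c' - u = e + \<beta> *\<^sub>R d" by (simp add: c' e_def d_def algebra_simps)
  have 2: "v - u = d + e" "c - v = - d" "c - u = e" by (auto simp: e_def d_def)
  have "(norm (e + \<beta> *\<^sub>R d))\<^sup>2 = (norm e)\<^sup>2 + 2 * \<beta> * (d \<bullet> e) + \<beta>\<^sup>2 * (norm d)\<^sup>2"
    unfolding power2_norm_eq_inner
    by (simp add: inner_add_left inner_add_right inner_commute power2_eq_square algebra_simps)
  moreover have "(c - v) \<bullet> (v - u) = - (d \<bullet> e) - (norm d)\<^sup>2"
    unfolding 2 power2_norm_eq_inner by (simp add: inner_add_right)
  ultimately show ?thesis
    unfolding 1 2 d_def[symmetric] using \<beta> by (simp add: field_simps power2_eq_square)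
qed

text \<open>
  Here \<open>s = 1 - \<beta>\<close>, the vector \<open>p\<close> goes from the last iterate to the prox center, \<open>q\<close> from the
  center to the new iterate, and \<open>r\<close> is the weight of the older optimality condition.  The worst value
  of \<open>p \<bullet> (p + q)\<close> is \<open>- (norm q)\<^sup>2 / 4\<close>.  Since \<open>r \<le> 2 * s\<close>, half of \<open>(norm q)\<^sup>2\<close> survives: one quarter
  is passed on to the next step, the other one dominates the cross term together with the quarter of
  \<open>(norm p)\<^sup>2\<close> received from the step before.
\<close>

lemma later_step_quadratic:
  fixes p q :: "'a::real_inner"
  assumes "0 \<le> r" "r \<le> 2 * s"
  shows "(norm (p + q))\<^sup>2 / 8 + (norm q)\<^sup>2 / 4
         \<le> (1 + s) / 2 * (norm q)\<^sup>2 + r * (p \<bullet> (p + q)) + (norm p)\<^sup>2 / 4"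
proof -
  have A: "p \<bullet> (p + q) = (norm (p + (1/2) *\<^sub>R q))\<^sup>2 - (norm q)\<^sup>2 / 4"
    unfolding power2_norm_eq_inner
    by (simp add: inner_add_left inner_add_right inner_commute)
  have "r * (norm q)\<^sup>2 \<le> 2 * s * (norm q)\<^sup>2" by (intro mult_right_mono assms) simp
  moreover have "0 \<le> r * (norm (p + (1/2) *\<^sub>R q))\<^sup>2" using assms by simp
  moreover have "(norm (p + q))\<^sup>2 = 2 * (norm p)\<^sup>2 + 2 * (norm q)\<^sup>2 - (norm (p - q))\<^sup>2"
    unfolding power2_norm_eq_inner by (simp add: inner_simps inner_commute)
  then have "(norm (p + q))\<^sup>2 \<le> 2 * (norm p)\<^sup>2 + 2 * (norm q)\<^sup>2" by simp
  ultimately show ?thesis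
    unfolding A right_diff_distrib by (simp add: add_divide_distrib algebra_simps)
qed

text \<open>
  The first step has received no quarter of \<open>(norm p)\<^sup>2\<close>, and the increment of the multiplier is replaced
  by a multiple of \<open>norm p\<close>, whence the product on the left.  The summand with \<open>5 / 4 * \<kappa>\<close> pays for this
  and ends up in the rate constant.
\<close>

lemma first_step_quadratic:
  fixes p q :: "'a::real_inner"
  assumes r: "0 \<le> r" "2 * r \<le> 3 * s" and \<kappa>: "0 \<le> \<kappa>" "\<kappa> \<le> 1 / 4"
  shows "\<kappa> * norm p * norm (p + q) + (norm q)\<^sup>2 / 4 + r / 4 * (norm p)\<^sup>2
         \<le> (1 + s) / 2 * (norm q)\<^sup>2 + r * (p \<bullet> (p + q)) + 5 / 4 * \<kappa> * (norm p)\<^sup>2"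
proof -
  have A: "p \<bullet> (p + q) - (norm p)\<^sup>2 / 4 = 3/4 * (norm (p + (2/3) *\<^sub>R q))\<^sup>2 - (norm q)\<^sup>2 / 3"
    unfolding power2_norm_eq_inner
    by (simp add: inner_add_left inner_add_right inner_commute add_divide_distrib)
  have "0 \<le> r * (3/4 * (norm (p + (2/3) *\<^sub>R q))\<^sup>2)" using r by simp
  also have "3/4 * (norm (p + (2/3) *\<^sub>R q))\<^sup>2 = p \<bullet> (p + q) - (norm p)\<^sup>2 / 4 + (norm q)\<^sup>2 / 3"
    using A by linarith
  also have "r * \<dots> = r * (p \<bullet> (p + q)) - r / 4 * (norm p)\<^sup>2 + r * (norm q)\<^sup>2 / 3"
    by (simp add: distrib_left right_diff_distrib)
  finally have 1: "r / 4 * (norm p)\<^sup>2 - r * (norm q)\<^sup>2 / 3 \<le> r * (p \<bullet> (p + q))" by simp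
  have 2: "2 * r * (norm q)\<^sup>2 \<le> 3 * s * (norm q)\<^sup>2" by (intro mult_right_mono r) simp
  have "norm p * norm (p + q) \<le> norm p * (norm p + norm q)"
    by (intro mult_left_mono norm_triangle_ineq) simp
  also have "\<dots> \<le> 5/4 * (norm p)\<^sup>2 + (norm q)\<^sup>2"
    using zero_le_power2[of "norm p / 2 - norm q"] by (simp add: power2_eq_square field_simps)
  finally have "\<kappa> * (norm p * norm (p + q)) \<le> \<kappa> * (5/4 * (norm p)\<^sup>2 + (norm q)\<^sup>2)"
    by (intro mult_left_mono \<kappa>)
  moreover have "\<kappa> * (norm q)\<^sup>2 \<le> 1 / 4 * (norm q)\<^sup>2" by (intro mult_right_mono \<kappa>) simp
  ultimately show ?thesis using 1 2 by (simp add: field_simps)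
qed

section \<open>Step sizes\<close>

lemma ereal_divide_nonneg_cases:
  fixes c d :: real
  assumes "c > 0" "d \<ge> 0"
  shows "d = 0 \<and> ereal c / ereal d = \<infinity> \<or> d > 0 \<and> ereal c / ereal d = ereal (c / d)"
  using assms by (cases "d = 0") (auto simp: divide_ereal_def divide_inverse)

text \<open>
  If \<open>d = 0\<close>, the quotient is infinite: it imposes no bound and does not attain the minimum.  In the
  multiplied form \<open>e * d \<le> c\<close> the upper bound holds in that case too.
\<close>

lemma ereal_min_divideD:
  fixes e a c d :: real
  assumes "ereal e = min (ereal a) (ereal c / ereal d)" "c > 0" "d \<ge> 0"
  shows "e \<le> a" "e * d \<le> c" "e = a \<or> d > 0 \<and> e = c / d"
  using ereal_divide_nonneg_cases[OF assms(2,3)] assms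
  by (auto simp: min_def field_simps split: if_splits)

lemma ereal_min3_divideD:
  fixes e a b c d :: real
  assumes "ereal e = min (ereal a) (min (ereal b) (ereal c / ereal d))" "c > 0" "d \<ge> 0"
  shows "e \<le> a" "e \<le> b" "e * d \<le> c" "e = a \<or> e = b \<or> d > 0 \<and> e = c / d"
proof -
  have "ereal e = min (ereal (min a b)) (ereal c / ereal d)"
    unfolding assms(1) ereal_min by (simp only: min.assoc)
  from ereal_min_divideD[OF this assms(2,3)]
  show "e \<le> a" "e \<le> b" "e * d \<le> c" "e = a \<or> e = b \<or> d > 0 \<and> e = c / d"
    by (auto simp: min_def split: if_splits)
qed

locale step_sizes =
  fixes \<mu> \<alpha> \<beta> :: real and L bs \<eta> \<tau> :: "nat \<Rightarrow> real"
  assumes \<mu>: "\<mu> > 0" and \<alpha>: "0 < \<alpha>" "\<alpha> \<le> 1" and \<beta>: "0 < \<beta>" "\<beta> \<le> 1 - sqrt 6 / 3"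
    and L_nonneg: "\<And>t. 0 \<le> L t"
    and rule: "step_size_rule \<mu> \<alpha> \<beta> L bs \<eta> \<tau>"
begin

lemma one_minus_\<beta>: "0 < 1 - \<beta>" "2 / 3 \<le> (1 - \<beta>)\<^sup>2"
proof -
  have s: "sqrt 6 / 3 \<le> 1 - \<beta>" using \<beta> by simp
  moreover have "(sqrt 6 / 3)\<^sup>2 = (2/3::real)" by (simp add: power_divide)
  ultimately show "2 / 3 \<le> (1 - \<beta>)\<^sup>2" by (metis power_mono real_sqrt_ge_0_iff divide_nonneg_nonneg zero_le_numeral)
  have "0 < sqrt 6 / (3::real)" by simp
  with s show "0 < 1 - \<beta>" by linarith
qed

lemma init: "\<eta> 1 > 0" "bs 1 = 0" "\<tau> 1 = 0" "\<tau> 2 = \<mu>" and bs: "t \<ge> 2 \<Longrightarrow> bs t = \<beta>"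
  using rule unfolding step_size_rule_def by blast+

lemma \<eta>2: "\<eta> 2 \<le> (1 - \<beta>) * \<eta> 1" "\<eta> 2 * (4 * (L 1)\<^sup>2) \<le> \<mu>"
    "\<eta> 2 = (1 - \<beta>) * \<eta> 1 \<or> 4 * (L 1)\<^sup>2 > 0 \<and> \<eta> 2 = \<mu> / (4 * (L 1)\<^sup>2)"
proof -
  have "ereal (\<eta> 2) = min (ereal ((1 - \<beta>) * \<eta> 1)) (ereal \<mu> / ereal (4 * (L 1)\<^sup>2))"
    using rule unfolding step_size_rule_def by blast
  note * = ereal_min_divideD[OF this \<mu>]
  show "\<eta> 2 \<le> (1 - \<beta>) * \<eta> 1" "\<eta> 2 * (4 * (L 1)\<^sup>2) \<le> \<mu>"
    "\<eta> 2 = (1 - \<beta>) * \<eta> 1 \<or> 4 * (L 1)\<^sup>2 > 0 \<and> \<eta> 2 = \<mu> / (4 * (L 1)\<^sup>2)"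
    by (rule *; simp)+
qed

lemma \<tau>_Suc:
  assumes "t \<ge> 2"
  shows "\<tau> (t + 1) = \<tau> t + \<mu> / 2 * (\<alpha> + (1 - \<alpha>) * (\<eta> (t + 1) * (4 * (L t)\<^sup>2) / \<tau> t))"
proof -
  have idx: "t + 1 - 1 = t" by simp
  have "3 \<le> t + 1" using assms by simp
  then have "\<tau> (t + 1) = \<tau> (t + 1 - 1)
      + \<mu> / 2 * (\<alpha> + (1 - \<alpha>) * \<eta> (t + 1) * (4 * (L (t + 1 - 1))\<^sup>2 / \<tau> (t + 1 - 1)))"
    using rule unfolding step_size_rule_def by blast
  then show ?thesis unfolding idx by simp
qed

lemma \<eta>_Suc:
  assumes t: "t \<ge> 2" and pos: "\<tau> t > 0"
  shows "\<eta> (t + 1) \<le> 4 / 3 * \<eta> t" "\<eta> (t + 1) \<le> (\<tau> (t - 1) + \<mu>) / \<tau> t * \<eta> t"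
    "\<eta> (t + 1) * (4 * (L t)\<^sup>2) \<le> \<tau> t"
    "\<eta> (t + 1) = 4 / 3 * \<eta> t \<or> \<eta> (t + 1) = (\<tau> (t - 1) + \<mu>) / \<tau> t * \<eta> t
      \<or> 4 * (L t)\<^sup>2 > 0 \<and> \<eta> (t + 1) = \<tau> t / (4 * (L t)\<^sup>2)"
proof -
  have idx: "t + 1 - 1 = t" "t + 1 - 2 = t - 1" by auto
  have "3 \<le> t + 1" using t by simp
  then have "ereal (\<eta> (t + 1)) = min (ereal (4 / 3 * \<eta> (t + 1 - 1)))
      (min (ereal ((\<tau> (t + 1 - 2) + \<mu>) / \<tau> (t + 1 - 1) * \<eta> (t + 1 - 1)))
           (ereal (\<tau> (t + 1 - 1)) / ereal (4 * (L (t + 1 - 1))\<^sup>2)))"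
    using rule unfolding step_size_rule_def by blast
  note * = ereal_min3_divideD[OF this[unfolded idx] pos]
  show "\<eta> (t + 1) \<le> 4 / 3 * \<eta> t" "\<eta> (t + 1) \<le> (\<tau> (t - 1) + \<mu>) / \<tau> t * \<eta> t"
    "\<eta> (t + 1) * (4 * (L t)\<^sup>2) \<le> \<tau> t"
    "\<eta> (t + 1) = 4 / 3 * \<eta> t \<or> \<eta> (t + 1) = (\<tau> (t - 1) + \<mu>) / \<tau> t * \<eta> t
      \<or> 4 * (L t)\<^sup>2 > 0 \<and> \<eta> (t + 1) = \<tau> t / (4 * (L t)\<^sup>2)"
    by (rule *; simp)+
qed

text \<open>
  The bounds are proved together: \<open>\<eta> (t + 1)\<close> is positive because \<open>\<tau> t\<close> is, and the increment of \<open>\<tau>\<close>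
  lies between \<open>\<mu> / 2 * \<alpha>\<close> and \<open>\<mu> / 2\<close> because the quotient in its update, which compares \<open>\<eta> (t + 1)\<close> with the
  third term of its minimum, lies between \<open>0\<close> and \<open>1\<close>.
\<close>

lemma \<eta>_\<tau>_bounds:
  assumes "t \<ge> 2"
  shows "0 < \<eta> t \<and> 0 \<le> \<tau> (t - 1)
    \<and> \<mu> * (1 + \<alpha> * (real t - 2) / 2) \<le> \<tau> t \<and> \<tau> t \<le> \<mu> * (1 + (real t - 2) / 2)"
  using assms
proof (induction t rule: nat_induct_at_least)
  case base
  have "0 < (1 - \<beta>) * \<eta> 1" using one_minus_\<beta> init by simp
  then have "0 < \<eta> 2" using \<eta>2(3) \<mu> by auto
  then show ?case using init \<mu> by simp
next
  case (Suc t)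
  have "0 \<le> \<alpha> * (real t - 2)" using \<alpha> Suc.hyps by simp
  then have "0 < \<mu> * (1 + \<alpha> * (real t - 2) / 2)" using \<mu> by (intro mult_pos_pos) auto
  then have \<tau>: "0 < \<tau> t" using Suc.IH by linarith
  have \<eta>: "0 < \<eta> (t + 1)"
    using \<eta>_Suc(4)[OF Suc.hyps \<tau>] Suc.IH \<mu> \<tau>
    by (auto intro!: mult_pos_pos divide_pos_pos)
  define e where "e = \<eta> (t + 1) * (4 * (L t)\<^sup>2) / \<tau> t"
  have e: "0 \<le> e" "e \<le> 1"
    using \<eta> \<tau> \<eta>_Suc(3)[OF Suc.hyps \<tau>] by (auto simp: e_def)
  have "(1 - \<alpha>) * e \<le> 1 - \<alpha>" using \<alpha> e by (simp add: mult_left_le)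
  then have br: "\<alpha> \<le> \<alpha> + (1 - \<alpha>) * e" "\<alpha> + (1 - \<alpha>) * e \<le> 1" using \<alpha> e by auto
  have "\<mu> / 2 * \<alpha> \<le> \<mu> / 2 * (\<alpha> + (1 - \<alpha>) * e)" "\<mu> / 2 * (\<alpha> + (1 - \<alpha>) * e) \<le> \<mu> / 2 * 1"
    using br \<mu> by (intro mult_left_mono; simp)+
  then have "\<tau> t + \<mu> / 2 * \<alpha> \<le> \<tau> (t + 1)" "\<tau> (t + 1) \<le> \<tau> t + \<mu> / 2"
    unfolding \<tau>_Suc[OF Suc.hyps] e_def by auto
  moreover have "\<mu> * (1 + \<alpha> * (real (Suc t) - 2) / 2) = \<mu> * (1 + \<alpha> * (real t - 2) / 2) + \<mu> / 2 * \<alpha>"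
    "\<mu> * (1 + (real (Suc t) - 2) / 2) = \<mu> * (1 + (real t - 2) / 2) + \<mu> / 2"
    by (auto simp: field_simps)
  ultimately show ?case using Suc.IH \<eta> \<tau> by auto
qed

lemma \<eta>_pos: "t \<ge> 1 \<Longrightarrow> 0 < \<eta> t"
  using \<eta>_\<tau>_bounds[of t] init by (cases "t = 1") auto

lemma \<tau>_pos: "t \<ge> 2 \<Longrightarrow> 0 < \<tau> t"
proof -
  assume t: "t \<ge> 2"
  have "0 \<le> \<alpha> * (real t - 2)" using \<alpha> t by simp
  then have "0 < \<mu> * (1 + \<alpha> * (real t - 2) / 2)" using \<mu> by (intro mult_pos_pos) auto
  then show ?thesis using \<eta>_\<tau>_bounds[OF t] by linarith
qed

lemma \<tau>_nonneg: "t \<ge> 1 \<Longrightarrow> 0 \<le> \<tau> t"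
  using \<tau>_pos[of t] init by (cases "t = 1") auto

text \<open>
  The second term of the step size rule, in the form that makes the weighted dual distances telescope.
\<close>

lemma \<eta>_\<tau>_mono:
  assumes "t \<ge> 2"
  shows "\<eta> (t + 1) * \<tau> t \<le> \<eta> t * (\<tau> (t - 1) + \<mu>)"
  using \<eta>_Suc(2)[OF assms \<tau>_pos[OF assms]] \<tau>_pos[OF assms] by (simp add: field_simps)

text \<open>
  The bounds on the weight \<open>r\<close> of the older optimality condition; for later steps it is the inequality
  \<open>4 / 3 \<le> 2 * (1 - \<beta>)\<^sup>2\<close>, which the assumption on \<open>\<beta>\<close> expresses.
\<close>

lemma \<eta>_ratio:
  assumes "t \<ge> 1"
  shows "\<eta> (t + 1) / (\<eta> t * (1 - bs t)) \<le> (if t = 1 then 1 else 2) * (1 - \<beta>)"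
proof (cases "t = 1")
  case True
  then show ?thesis using init \<eta>2(1) by (simp add: field_simps one_add_one[symmetric] del: one_add_one)
next
  case False
  then have t: "t \<ge> 2" using assms by simp
  have "\<eta> (t + 1) \<le> 4 / 3 * \<eta> t" using \<eta>_Suc(1)[OF t \<tau>_pos[OF t]] .
  also have "\<dots> \<le> 2 * (1 - \<beta>)\<^sup>2 * \<eta> t"
    using one_minus_\<beta> \<eta>_pos[OF assms] by (intro mult_right_mono) auto
  finally show ?thesis
    using one_minus_\<beta> \<eta>_pos[OF assms] bs[OF t] False
    by (simp add: divide_le_eq power2_eq_square mult_ac)
qed

abbreviation Lh :: "nat \<Rightarrow> real" where
  "Lh \<equiv> L_hat \<mu> \<beta> (\<eta> 1) L"

text \<open>
  The initial entry in the maximum accounts for the case that \<open>\<eta> 2\<close> is limited by \<open>\<eta> 1\<close>.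
\<close>

lemma L_hat_initial_bound: "\<mu> \<le> (1 - \<beta>) * \<eta> 1 * (4 * (Lh t)\<^sup>2)"
proof -
  have pos: "0 < 4 * (1 - \<beta>) * \<eta> 1" using one_minus_\<beta> init by simp
  have "sqrt (\<mu> / (4 * (1 - \<beta>) * \<eta> 1)) \<le> Lh t" unfolding L_hat_def by (intro Max_ge) auto
  then have "(sqrt (\<mu> / (4 * (1 - \<beta>) * \<eta> 1)))\<^sup>2 \<le> (Lh t)\<^sup>2"
    using pos \<mu> by (intro power_mono) auto
  then show ?thesis using pos \<mu> by (simp add: field_simps)
qed

lemma L_hat_pos: "0 < Lh t"
proof -
  have "0 < sqrt (\<mu> / (4 * (1 - \<beta>) * \<eta> 1))" using one_minus_\<beta> init \<mu> by simp
  also have "\<dots> \<le> Lh t" unfolding L_hat_def by (intro Max_ge) auto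
  finally show ?thesis .
qed

lemma L_le_L_hat: "1 \<le> i \<Longrightarrow> i \<le> t \<Longrightarrow> L i \<le> Lh t"
  unfolding L_hat_def by (intro Max_ge) auto

lemma L_hat_mono: "s \<le> t \<Longrightarrow> Lh s \<le> Lh t"
  unfolding L_hat_def by (intro Max_mono) auto

text \<open>
  Induction over the three terms of the step size rule.  For the third term, \<open>\<tau> t\<close> grows faster than the
  claimed bound.  For the first, the factor \<open>4 / 3\<close> exceeds the growth of the bound.  For the second, the
  upper bound on \<open>\<tau>\<close> limits how slowly the factor \<open>(\<tau> (t - 1) + \<mu>) / \<tau> t\<close> lets the step sizes grow.

  The case \<open>t = 2\<close> claims more than the general formula: as \<open>\<tau> 1 = 0\<close>, the second term does not let the
  step size grow from \<open>t = 2\<close> to \<open>t = 3\<close>, and the bound at \<open>t = 3\<close> is already \<open>\<mu>\<close>.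
\<close>

lemma \<eta>_scaled_lower_bound:
  assumes "t \<ge> 2"
  shows "(if t = 2 then 1 else 1 + \<alpha> * (real t - 3) / 3) * \<mu> \<le> \<eta> t * (4 * (Lh (t - 1))\<^sup>2)"
  using assms
proof (induction t rule: nat_induct_at_least)
  case base
  have "(L 1)\<^sup>2 \<le> (Lh 1)\<^sup>2" using L_le_L_hat[of 1 1] L_nonneg by (intro power_mono) auto
  then show ?case using \<eta>2(3) L_hat_initial_bound[of 1] \<mu>
    by (auto simp: pos_le_divide_eq)
next
  case (Suc t)
  note t = Suc.hyps
  define D where "D = 4 * (Lh t)\<^sup>2"
  define j where "j = real t - 2"
  define c where "c = 1 + \<alpha> * j / 3"
  have D: "D > 0" using L_hat_pos[of t] by (simp add: D_def)
  have j: "0 \<le> j" using t by (simp add: j_def)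
  have "(Lh (t - 1))\<^sup>2 \<le> (Lh t)\<^sup>2"
    using L_hat_mono[of "t - 1" t] L_hat_pos[of "t - 1"] by (intro power_mono) auto
  then have "\<eta> t * (4 * (Lh (t - 1))\<^sup>2) \<le> \<eta> t * D"
    unfolding D_def using \<eta>_pos[of t] t by (intro mult_left_mono) auto
  then have IH: "(if t = 2 then 1 else 1 + \<alpha> * (real t - 3) / 3) * \<mu> \<le> \<eta> t * D"
    using Suc.IH by linarith
  have \<tau>t: "0 < \<tau> t" using \<tau>_pos[OF t] .
  have \<tau>_lo: "\<mu> * (1 + \<alpha> * j / 2) \<le> \<tau> t" using \<eta>_\<tau>_bounds[OF t] by (simp add: j_def)
  consider "\<eta> (t + 1) = 4 / 3 * \<eta> t" | "\<eta> (t + 1) = (\<tau> (t - 1) + \<mu>) / \<tau> t * \<eta> t"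
    | "4 * (L t)\<^sup>2 > 0" "\<eta> (t + 1) = \<tau> t / (4 * (L t)\<^sup>2)"
    using \<eta>_Suc(4)[OF t \<tau>t] by blast
  then have "c * \<mu> \<le> \<eta> (t + 1) * D"
  proof cases
    case 1
    have "c \<le> 4 / 3 * (if t = 2 then 1 else 1 + \<alpha> * (real t - 3) / 3)"
    proof (cases "t = 2")
      case False
      then have "real t \<ge> 3" using t by linarith
      define a where "a = \<alpha> * real t"
      have "\<alpha> * 3 \<le> a"
        unfolding a_def using \<alpha> \<open>real t \<ge> 3\<close> by (intro mult_left_mono) auto
      moreover have "c = 1 + (a - \<alpha> * 2) / 3"
        by (simp add: c_def j_def a_def algebra_simps)
      ultimately have "c \<le> 4 / 3 * (1 + (a - \<alpha> * 3) / 3)" using \<alpha> by (simp add: field_simps)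
      also have "a - \<alpha> * 3 = \<alpha> * (real t - 3)"
        by (simp add: a_def algebra_simps)
      finally have "c \<le> 4 / 3 * (1 + \<alpha> * (real t - 3) / 3)" .
      then show ?thesis using False by simp
    qed (simp add: c_def j_def)
    then have "c * \<mu> \<le> 4 / 3 * ((if t = 2 then 1 else 1 + \<alpha> * (real t - 3) / 3) * \<mu>)"
      using \<mu> by simp
    also have "\<dots> \<le> 4 / 3 * (\<eta> t * D)" using IH by linarith
    finally show ?thesis unfolding 1 by (simp only: mult.assoc)
  next
    case 2
    show ?thesis
    proof (cases "t = 2")
      case True
      then show ?thesis using 2 IH init \<mu> by (simp add: c_def j_def)
    next
      case False
      then have t3: "t \<ge> 3" using t by simp
      \<comment> \<open>in units of \<open>\<mu>\<close>: with \<open>\<tau> t\<close> at most \<open>T + 1 / 2\<close>, the factor \<open>(T + 1) / (T + 1 / 2)\<close>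
        still lifts \<open>e\<close> to \<open>e + \<alpha> / 3\<close>, because \<open>T\<close> is at most \<open>1 + (t - 3) / 2\<close>\<close>
      define T where "T = \<tau> (t - 1) / \<mu>"
      define e where "e = 1 + \<alpha> * (real t - 3) / 3"
      have e: "e \<ge> 1" "c = e + \<alpha> / 3"
        using \<alpha> t3 by (auto simp: c_def e_def j_def field_simps)
      have t1: "2 \<le> t - 1" using t3 by simp
      have T0: "T \<ge> 0" "T * \<mu> = \<tau> (t - 1)" using \<mu> \<tau>_pos[OF t1] by (auto simp: T_def)
      have "\<tau> (t - 1) \<le> \<mu> * (1 + (real (t - 1) - 2) / 2)" using \<eta>_\<tau>_bounds[OF t1] by simp
      then have "T \<le> 1 + (real t - 3) / 2"
        unfolding T_def using t3 \<mu> by (simp add: field_simps of_nat_diff)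
      then have "\<alpha> * T \<le> \<alpha> * (1 + (real t - 3) / 2)" using \<alpha> by (intro mult_left_mono) auto
      then have aT: "\<alpha> * T / 3 \<le> \<alpha> / 3 + (e - 1) / 2" by (simp add: e_def field_simps)
      define f where "f = \<eta> t * (4 * (L (t - 1))\<^sup>2) / \<tau> (t - 1)"
      have f: "f \<le> 1"
        using \<eta>_Suc(3)[OF t1 \<tau>_pos[OF t1]] \<tau>_pos[OF t1] t3 by (simp add: f_def)
      have "(1 - \<alpha>) * f \<le> (1 - \<alpha>) * 1" using \<alpha> f by (intro mult_left_mono) auto
      then have "\<mu> / 2 * (\<alpha> + (1 - \<alpha>) * f) \<le> \<mu> / 2 * 1" using \<mu> by (intro mult_left_mono) auto
      then have \<tau>T: "\<tau> t \<le> (T + 1 / 2) * \<mu>"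
        using \<tau>_Suc[OF t1] t3 T0 by (simp add: f_def algebra_simps)
      define P where "P = \<alpha> * T / 3"
      have "c * (T + 1 / 2) = e * T + e / 2 + (P + \<alpha> / 6)"
        unfolding e(2) P_def by (simp add: field_simps)
      also have "\<dots> \<le> e * T + e" using aT[folded P_def] \<alpha> by (simp add: field_simps)
      also have "\<dots> = (T + 1) * e" by (simp add: algebra_simps)
      finally have cT: "c * (T + 1 / 2) \<le> (T + 1) * e" .
      have "c * \<tau> t \<le> c * ((T + 1 / 2) * \<mu>)" using \<tau>T e \<alpha> by (intro mult_left_mono) auto
      also have "\<dots> = c * (T + 1 / 2) * \<mu>" by (simp only: mult.assoc)
      also have "\<dots> \<le> (T + 1) * e * \<mu>" using cT \<mu> by (intro mult_right_mono) auto
      finally have "c * \<tau> t \<le> (T + 1) * e * \<mu>" .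
      then have "\<mu> * (c * \<tau> t) \<le> \<mu> * ((T + 1) * e * \<mu>)"
        using \<mu> by (intro mult_left_mono) auto
      then have "c * \<mu> * \<tau> t \<le> (T + 1) * \<mu> * (e * \<mu>)"
        by (simp only: mult_ac)
      also have "\<dots> \<le> (T + 1) * \<mu> * (\<eta> t * D)"
        using IH False T0 \<mu> by (intro mult_left_mono) (auto simp: e_def)
      also have "(T + 1) * \<mu> = \<tau> (t - 1) + \<mu>" using T0 by (simp add: algebra_simps)
      finally have "c * \<mu> \<le> (\<tau> (t - 1) + \<mu>) * (\<eta> t * D) / \<tau> t"
        using \<tau>t by (simp only: pos_le_divide_eq)
      then show ?thesis unfolding 2 by (simp only: times_divide_eq_left mult.assoc)
    qed
  next
    case 3
    have "(L t)\<^sup>2 \<le> (Lh t)\<^sup>2" using L_le_L_hat[of t t] L_nonneg t by (intro power_mono) auto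
    then have "\<tau> t * (4 * (L t)\<^sup>2) \<le> \<tau> t * D" unfolding D_def using \<tau>t by simp
    then have "\<tau> t \<le> \<eta> (t + 1) * D" unfolding 3(2) using 3(1) by (simp add: pos_le_divide_eq)
    moreover have "c * \<mu> \<le> \<mu> * (1 + \<alpha> * j / 2)"
      using \<mu> \<alpha> j by (simp add: c_def mult.commute)
    ultimately show ?thesis using \<tau>_lo by linarith
  qed
  then show ?case using t by (simp add: c_def D_def j_def)
qed

lemma \<eta>_lower_bound:
  assumes "t \<ge> 2"
  shows "(3 + \<alpha> * (real t - 3)) * \<mu> / (12 * (Lh (t - 1))\<^sup>2) \<le> \<eta> t"
proof -
  have "(1 + \<alpha> * (real t - 3) / 3) * \<mu> \<le> \<eta> t * (4 * (Lh (t - 1))\<^sup>2)"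
  proof -
    have "1 + \<alpha> * (real t - 3) / 3 \<le> (if t = 2 then 1 else 1 + \<alpha> * (real t - 3) / 3)"
      using \<alpha> by simp
    then have "(1 + \<alpha> * (real t - 3) / 3) * \<mu> \<le> (if t = 2 then 1 else 1 + \<alpha> * (real t - 3) / 3) * \<mu>"
      using \<mu> by (intro mult_right_mono) auto
    then show ?thesis using \<eta>_scaled_lower_bound[OF assms] by linarith
  qed
  then show ?thesis using L_hat_pos[of "t - 1"] by (simp add: field_simps)
qed

lemma rate_denominator_pos: "k \<ge> 1 \<Longrightarrow> 0 < 6 * real k + \<alpha> * real k * (real k - 3)"
proof -
  assume k: "k \<ge> 1"
  have "\<alpha> * (real k - 3) \<ge> \<alpha> * (-2)" using \<alpha> k by (intro mult_left_mono) auto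
  then have "0 < real k * (6 + \<alpha> * (real k - 3))" using \<alpha> k by (intro mult_pos_pos) auto
  then show ?thesis by (simp add: algebra_simps)
qed

lemma sum_\<eta>_lower_bound:
  shows "\<mu> * (6 * real k + \<alpha> * real k * (real k - 3)) \<le> 24 * (Lh k)\<^sup>2 * (\<Sum>t=1..k. \<eta> (t + 1))"
proof -
  have "(3 + \<alpha> * (real t - 2)) * \<mu> \<le> 12 * (Lh k)\<^sup>2 * \<eta> (t + 1)" if "t \<in> {1..k}" for t
  proof -
    have "(Lh t)\<^sup>2 \<le> (Lh k)\<^sup>2"
      using L_hat_mono[of t k] L_hat_pos[of t] that by (intro power_mono) auto
    then have "12 * (Lh t)\<^sup>2 * \<eta> (t + 1) \<le> 12 * (Lh k)\<^sup>2 * \<eta> (t + 1)"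
      using \<eta>_pos[of "t + 1"] by (intro mult_right_mono) auto
    moreover have "(3 + \<alpha> * (real t - 2)) * \<mu> \<le> 12 * (Lh t)\<^sup>2 * \<eta> (t + 1)"
      using \<eta>_lower_bound[of "t + 1"] that L_hat_pos[of t]
      by (simp add: divide_le_eq mult_ac)
    ultimately show ?thesis by linarith
  qed
  then have "(\<Sum>t=1..k. (3 + \<alpha> * (real t - 2)) * \<mu>) \<le> (\<Sum>t=1..k. 12 * (Lh k)\<^sup>2 * \<eta> (t + 1))"
    by (intro sum_mono) auto
  moreover have "(\<Sum>t=1..k. (3 + \<alpha> * (real t - 2)) * \<mu>)
      = \<mu> * (6 * real k + \<alpha> * real k * (real k - 3)) / 2"
    by (induction k) (auto simp: field_simps)
  ultimately show ?thesis by (simp add: sum_distrib_left[symmetric])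
qed

end

section \<open>One iteration of the method\<close>

lemma norm_squared_on_segment:
  fixes a e :: "'a::real_inner"
  shows "(norm ((1 - l) *\<^sub>R a + l *\<^sub>R e))\<^sup>2
         = (norm a)\<^sup>2 + l * (2 * (a \<bullet> (e - a))) + l\<^sup>2 * (norm (e - a))\<^sup>2"
  unfolding power2_norm_eq_inner
  by (simp add: inner_simps inner_commute algebra_simps power2_eq_square)

lemma inner_transpose_vector:
  fixes K :: "real^'n^'m"
  shows "(transpose K *v y) \<bullet> v = y \<bullet> (K *v v)"
  by (simp add: transpose_matrix_vector dot_lmul_matrix)

lemma primal_argmin_first_order:
  fixes K :: "real^'n^'m"
  assumes F: "convex_on X F" and e: "e \<ge> 0"
    and min: "argmin_on (\<lambda>u. e * ((transpose K *v y) \<bullet> u + F u) + 1 / 2 * (norm (c - u))\<^sup>2) X v"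
    and u: "u \<in> X"
  shows "e * (y \<bullet> (K *v (v - u)) + F v - F u) \<le> (c - v) \<bullet> (v - u)"
proof -
  define q where "q z = e * (y \<bullet> (K *v z)) + 1 / 2 * (norm (c - z))\<^sup>2" for z
  have "argmin_on (\<lambda>z. e * F z + q z) X v"
    using min unfolding q_def inner_transpose_vector by (simp only: distrib_left ac_simps)
  moreover have "q ((1 - l) *\<^sub>R v + l *\<^sub>R u)
      \<le> q v + l * (e * (y \<bullet> (K *v (u - v))) - (c - v) \<bullet> (u - v)) + l\<^sup>2 * ((norm (u - v))\<^sup>2 / 2)" for l
  proof -
    have "c - ((1 - l) *\<^sub>R v + l *\<^sub>R u) = (1 - l) *\<^sub>R (c - v) + l *\<^sub>R (c - u)"
      by (simp add: algebra_simps)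
    then have "(norm (c - ((1 - l) *\<^sub>R v + l *\<^sub>R u)))\<^sup>2
        = (norm (c - v))\<^sup>2 + l * (2 * ((c - v) \<bullet> (v - u))) + l\<^sup>2 * (norm (u - v))\<^sup>2"
      by (simp add: norm_squared_on_segment norm_minus_commute)
    moreover have "(c - v) \<bullet> (u - v) = - ((c - v) \<bullet> (v - u))"
      by (simp add: inner_diff_right)
    moreover have "y \<bullet> (K *v ((1 - l) *\<^sub>R v + l *\<^sub>R u))
        = y \<bullet> (K *v v) + l * (y \<bullet> (K *v (u - v)))"
      by (simp add: matrix_vector_right_distrib matrix_vector_mult_diff_distrib
          matrix_vector_mult_scaleR inner_simps algebra_simps)
    ultimately show ?thesis unfolding q_def by (simp add: algebra_simps)
  qed
  ultimately have "e * F v \<le> e * F u + (e * (y \<bullet> (K *v (u - v))) - (c - v) \<bullet> (u - v))"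
    using argmin_first_order[OF convex_on_cmul[OF e F]] u by blast
  then show ?thesis
    by (simp add: matrix_vector_mult_diff_distrib inner_simps algebra_simps)
qed

text \<open>
  The multiplier update is exactly the negative gradient of the quadratic term with respect to \<open>B *v w\<close>,
  so the new multiplier certifies optimality of \<open>w\<close> for \<open>G v - y' \<bullet> (B *v v)\<close>.
\<close>

lemma auxiliary_argmin_first_order:
  fixes B :: "real^'p^'m"
  assumes G: "convex_on W G" and \<sigma>: "\<sigma> > 0"
    and min: "argmin_on (\<lambda>v. G v + 1 / \<sigma> * (- \<theta> * (y \<bullet> (B *v v))
                        + 1 / 2 * (norm (B *v v - d))\<^sup>2)) W w"
    and y': "y' = (\<theta> *\<^sub>R y - (B *v w - d)) /\<^sub>R \<sigma>"
    and v: "v \<in> W"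
  shows "G w \<le> G v - y' \<bullet> (B *v (v - w))"
proof -
  define q where "q z = 1 / \<sigma> * (- \<theta> * (y \<bullet> (B *v z)) + 1 / 2 * (norm (B *v z - d))\<^sup>2)" for z
  have "q ((1 - l) *\<^sub>R w + l *\<^sub>R v)
      \<le> q w + l * - (y' \<bullet> (B *v (v - w))) + l\<^sup>2 * ((norm (B *v (v - w)))\<^sup>2 / (2 * \<sigma>))" for l
  proof -
    have "B *v ((1 - l) *\<^sub>R w + l *\<^sub>R v) - d = (1 - l) *\<^sub>R (B *v w - d) + l *\<^sub>R (B *v v - d)"
      by (simp add: matrix_vector_right_distrib matrix_vector_mult_scaleR algebra_simps)
    then have n: "(norm (B *v ((1 - l) *\<^sub>R w + l *\<^sub>R v) - d))\<^sup>2
        = (norm (B *v w - d))\<^sup>2 + l * (2 * ((B *v w - d) \<bullet> (B *v (v - w))))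
          + l\<^sup>2 * (norm (B *v (v - w)))\<^sup>2"
      by (simp add: norm_squared_on_segment matrix_vector_mult_diff_distrib)
    have i: "y \<bullet> (B *v ((1 - l) *\<^sub>R w + l *\<^sub>R v))
        = y \<bullet> (B *v w) + l * (y \<bullet> (B *v (v - w)))"
      by (simp add: matrix_vector_right_distrib matrix_vector_mult_diff_distrib
          matrix_vector_mult_scaleR inner_simps algebra_simps)
    have y'_inner: "y' \<bullet> (B *v (v - w))
        = 1 / \<sigma> * (\<theta> * (y \<bullet> (B *v (v - w))) - (B *v w - d) \<bullet> (B *v (v - w)))"
      unfolding y' by (simp add: inner_diff_left divide_inverse mult.commute)
    have "1 / \<sigma> * (- \<theta> * (Y + l * C) + 1 / 2 * (N + l * (2 * A) + l\<^sup>2 * M))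
        = 1 / \<sigma> * (- \<theta> * Y + 1 / 2 * N) + l * - (1 / \<sigma> * (\<theta> * C - A)) + l\<^sup>2 * (M / (2 * \<sigma>))"
      for Y C N A M :: real
      using \<sigma> by (simp add: field_simps)
    then show ?thesis unfolding q_def n i y'_inner by (simp only: order_refl)
  qed
  from argmin_first_order[OF G min[folded q_def] v this] show ?thesis by simp
qed

locale ac_admm_run =
  step_sizes \<mu> \<alpha> \<beta> "local_norm K y" bs \<eta> \<tau>
  for X :: "(real^'n) set" and W :: "(real^'p) set"
    and F :: "real^'n \<Rightarrow> real" and G :: "real^'p \<Rightarrow> real"
    and K :: "real^'n^'m" and B :: "real^'p^'m" and b :: "real^'m"
    and \<mu> \<alpha> \<beta> :: real and bs \<eta> \<tau> :: "nat \<Rightarrow> real"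
    and x xb :: "nat \<Rightarrow> real^'n" and w :: "nat \<Rightarrow> real^'p" and y :: "nat \<Rightarrow> real^'m" +
  fixes xs :: "real^'n" and ws :: "real^'p"
  assumes F: "convex_on X F" and G: "convex_on W G"
    and run: "ac_admm X W F G K B b \<mu> bs \<eta> \<tau> x xb w y"
    and xs: "xs \<in> X" and ws: "ws \<in> W" and feasible: "K *v xs - B *v ws + b = 0"
begin

abbreviation L :: "nat \<Rightarrow> real" where
  "L \<equiv> local_norm K y"

abbreviation residual :: "nat \<Rightarrow> real^'m" where
  "residual t \<equiv> K *v x t - B *v w t + b"

lemma x_init: "x 0 \<in> X" "xb 0 = x 0"
  and w_init: "argmin_on (\<lambda>v. G v + 1 / (2 * \<mu>) * (norm (B *v v - K *v x 0 - b))\<^sup>2) W (w 0)"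
  and y_init: "y 0 = (K *v x 0 - B *v w 0 + b) /\<^sub>R \<mu>"
  and x_argmin: "t \<ge> 1 \<Longrightarrow> argmin_on (\<lambda>u. \<eta> t * ((transpose K *v y (t - 1)) \<bullet> u + F u)
                        + 1 / 2 * (norm (xb (t - 1) - u))\<^sup>2) X (x t)"
  and xb_step: "t \<ge> 1 \<Longrightarrow> xb t = (1 - bs t) *\<^sub>R xb (t - 1) + bs t *\<^sub>R x t"
  and w_argmin: "t \<ge> 1 \<Longrightarrow> argmin_on (\<lambda>v. G v + 1 / (\<tau> t + \<mu>) * (- \<tau> t * (y (t - 1) \<bullet> (B *v v))
                        + 1 / 2 * (norm (B *v v - K *v x t - b))\<^sup>2)) W (w t)"
  and y_step: "t \<ge> 1 \<Longrightarrow> y t = (\<tau> t *\<^sub>R y (t - 1) - (B *v w t - K *v x t - b)) /\<^sub>R (\<tau> t + \<mu>)"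
  using run unfolding ac_admm_def by blast+

lemma x_in: "x t \<in> X"
  using x_init(1) x_argmin[of t] by (cases "t = 0") (auto simp: is_arg_min_def)

lemma w_in: "w t \<in> W"
  using w_init w_argmin[of t] by (cases "t = 0") (auto simp: is_arg_min_def)

lemma \<tau>_\<mu>_pos: "t \<ge> 1 \<Longrightarrow> 0 < \<tau> t + \<mu>"
  using \<tau>_nonneg[of t] \<mu> by simp

lemma x_optimality:
  assumes "t \<ge> 1" "u \<in> X"
  shows "\<eta> t * (y (t - 1) \<bullet> (K *v (x t - u)) + F (x t) - F u) \<le> (xb (t - 1) - x t) \<bullet> (x t - u)"
  using primal_argmin_first_order[OF F _ x_argmin[OF assms(1)] assms(2)] \<eta>_pos[OF assms(1)] by simp

lemma w_optimality:
  assumes v: "v \<in> W"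
  shows "G (w t) \<le> G v - y t \<bullet> (B *v (v - w t))"
proof (cases "t = 0")
  case True
  \<comment> \<open>the initial subproblem is the general one with \<open>\<theta> = 0\<close>, without a previous multiplier\<close>
  have "argmin_on (\<lambda>v. G v + 1 / \<mu> * (- 0 * (0 \<bullet> (B *v v))
                        + 1 / 2 * (norm (B *v v - (K *v x 0 + b)))\<^sup>2)) W (w 0)"
    using w_init by (simp add: diff_diff_eq mult.commute)
  from auxiliary_argmin_first_order[OF G \<mu> this _ v, of "y 0"] show ?thesis
    unfolding True by (simp add: y_init diff_diff_eq algebra_simps)
next
  case False
  then have t: "t \<ge> 1" by simp
  show ?thesis
    using auxiliary_argmin_first_order[OF G \<tau>_\<mu>_pos[OF t] w_argmin[OF t, unfolded diff_diff_eq]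
        y_step[OF t, unfolded diff_diff_eq] v] .
qed

lemma residual_eq:
  assumes "t \<ge> 1"
  shows "residual t = \<mu> *\<^sub>R y t + \<tau> t *\<^sub>R (y t - y (t - 1))"
proof -
  have "(\<tau> t + \<mu>) *\<^sub>R y t = \<tau> t *\<^sub>R y (t - 1) - (B *v w t - K *v x t - b)"
    using \<tau>_\<mu>_pos[OF assms] by (subst y_step[OF assms]) simp
  then show ?thesis by (simp add: algebra_simps)
qed

lemma cross_term_bound:
  "\<bar>(y t - y (t - 1)) \<bullet> (K *v v)\<bar> \<le> L t * norm (y t - y (t - 1)) * norm v"
proof -
  have "norm (transpose K *v (y t - y (t - 1))) = L t * norm (y t - y (t - 1))"
    by (simp add: local_norm_def)
  then show ?thesis
    using Cauchy_Schwarz_ineq2[of "transpose K *v (y t - y (t - 1))" v]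
    unfolding inner_transpose_vector by simp
qed

text \<open>
  As \<open>\<tau> 1 = 0\<close>, both \<open>y 0\<close> and \<open>y 1\<close> are the exact multipliers \<open>residual / \<mu>\<close> at \<open>x 0\<close> and \<open>x 1\<close>.  They
  maximize \<open>\<mu>\<close>-strongly concave functions that differ by the linear term of \<open>K *v (x 1 - x 0)\<close>.  The strong
  concavity shows up as monotonicity: adding the two optimality conditions for \<open>w\<close> gives
  \<open>(y 1 - y 0) \<bullet> (B *v (w 1 - w 0)) \<ge> 0\<close>.
\<close>

lemma first_dual_increment:
  "\<mu> * norm (y 1 - y 0) \<le> L 1 * norm (x 1 - x 0)"
proof -
  define d where "d = y 1 - y 0"
  have "\<mu> *\<^sub>R y 0 = residual 0" using \<mu> by (simp add: y_init)
  moreover have "\<mu> *\<^sub>R y 1 = residual 1" using residual_eq[of 1] init by simp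
  ultimately have d: "\<mu> *\<^sub>R d = K *v (x 1 - x 0) - B *v (w 1 - w 0)"
    by (simp add: d_def algebra_simps matrix_vector_mult_diff_distrib)
  have "0 \<le> d \<bullet> (B *v (w 1 - w 0))"
    using w_optimality[OF w_in, of 1 0] w_optimality[OF w_in, of 0 1]
    by (simp add: d_def matrix_vector_mult_diff_distrib inner_simps)
  then have "\<mu> * (norm d)\<^sup>2 \<le> d \<bullet> (K *v (x 1 - x 0))"
    using arg_cong[OF d, of "\<lambda>z. d \<bullet> z"] by (simp add: inner_diff_right power2_norm_eq_inner)
  also have "\<dots> \<le> L 1 * norm d * norm (x 1 - x 0)"
    using cross_term_bound[of 1 "x 1 - x 0"] by (simp add: d_def)
  finally have "norm d * (\<mu> * norm d) \<le> norm d * (L 1 * norm (x 1 - x 0))"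
    by (simp add: power2_eq_square mult_ac)
  moreover have "0 \<le> L 1 * norm (x 1 - x 0)" using L_nonneg[of 1] by simp
  ultimately show ?thesis unfolding d_def[symmetric] by (cases "d = 0") auto
qed

text \<open>
  The sum of the optimality condition of \<open>x (t + 1)\<close>, tested at \<open>xs\<close>, and \<open>\<eta> (t + 1) / \<eta> t\<close> times that
  of \<open>x t\<close>, tested at \<open>x (t + 1)\<close>.  The values \<open>F (x (t + 1))\<close> cancel, so \<open>\<eta> (t + 1)\<close> becomes the weight of
  \<open>x t\<close>.  The prox center \<open>xb (t - 1)\<close> of the older condition is expressed through \<open>xb t\<close>, which lies on
  the segment from it to \<open>x t\<close>.
\<close>

lemma primal_step:
  assumes t: "t \<ge> 1"
  defines "p \<equiv> xb t - x t" and "q \<equiv> x (t + 1) - xb t"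
    and "r \<equiv> \<eta> (t + 1) / (\<eta> t * (1 - bs t))"
  shows "\<eta> (t + 1) * (y t \<bullet> (K *v (x t - xs)) + F (x t) - F xs + (y t - y (t - 1)) \<bullet> (K *v (p + q)))
    \<le> ((norm (xb t - xs))\<^sup>2 - (norm (xb (t + 1) - xs))\<^sup>2) / (2 * \<beta>)
      - (1 - \<beta> / 2) * (norm q)\<^sup>2 - r * (p \<bullet> (p + q))"
proof -
  have bs1: "bs (t + 1) = \<beta>" using bs[of "t + 1"] t by simp
  have one_minus_bs: "0 < 1 - bs t" using bs[of t] init one_minus_\<beta> t by (cases "t = 1") auto
  have xb1: "xb (t + 1) = (1 - \<beta>) *\<^sub>R xb t + \<beta> *\<^sub>R x (t + 1)"
    using xb_step[of "t + 1"] bs1 by simp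
  have A: "\<eta> (t + 1) * (y t \<bullet> (K *v (x (t + 1) - xs)) + F (x (t + 1)) - F xs)
     \<le> ((norm (xb t - xs))\<^sup>2 - (norm (xb (t + 1) - xs))\<^sup>2) / (2 * \<beta>) - (1 - \<beta> / 2) * (norm q)\<^sup>2"
    using x_optimality[OF _ xs, of "t + 1"]
    unfolding q_def prox_of_averaged_center[OF xb1 \<beta>(1), symmetric] by simp
  have pq: "p + q = x (t + 1) - x t" by (simp add: p_def q_def)
  have p: "p = (1 - bs t) *\<^sub>R (xb (t - 1) - x t)"
    unfolding p_def by (subst xb_step[OF t]) (simp add: algebra_simps)
  have "\<eta> t * (y (t - 1) \<bullet> (K *v (x t - x (t + 1))) + F (x t) - F (x (t + 1)))
     \<le> (xb (t - 1) - x t) \<bullet> (x t - x (t + 1))"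
    by (rule x_optimality[OF t x_in])
  also have "\<dots> = - (p \<bullet> (p + q)) / (1 - bs t)"
  proof -
    have "p \<bullet> (p + q) = (1 - bs t) * ((xb (t - 1) - x t) \<bullet> (p + q))"
      by (subst p) (rule inner_scaleR_left)
    moreover have "x t - x (t + 1) = - (p + q)" by (simp add: pq)
    ultimately show ?thesis using one_minus_bs by (simp only: inner_minus_right) simp
  qed
  finally have "\<eta> (t + 1) / \<eta> t *
      (\<eta> t * (y (t - 1) \<bullet> (K *v (x t - x (t + 1))) + F (x t) - F (x (t + 1))))
     \<le> \<eta> (t + 1) / \<eta> t * (- (p \<bullet> (p + q)) / (1 - bs t))"
    using \<eta>_pos[of t] \<eta>_pos[of "t + 1"] t by (intro mult_left_mono) auto
  then have B: "\<eta> (t + 1) * (y (t - 1) \<bullet> (K *v (x t - x (t + 1))) + F (x t) - F (x (t + 1)))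
     \<le> - r * (p \<bullet> (p + q))"
    unfolding r_def using \<eta>_pos[OF t] by simp
  have "y t \<bullet> (K *v (x t - xs)) + F (x t) - F xs + (y t - y (t - 1)) \<bullet> (K *v (p + q))
    = (y t \<bullet> (K *v (x (t + 1) - xs)) + F (x (t + 1)) - F xs)
      + (y (t - 1) \<bullet> (K *v (x t - x (t + 1))) + F (x t) - F (x (t + 1)))"
    unfolding pq by (simp add: matrix_vector_mult_diff_distrib inner_simps)
  then have "\<eta> (t + 1) * (y t \<bullet> (K *v (x t - xs)) + F (x t) - F xs + (y t - y (t - 1)) \<bullet> (K *v (p + q)))
    = \<eta> (t + 1) * (y t \<bullet> (K *v (x (t + 1) - xs)) + F (x (t + 1)) - F xs)
      + \<eta> (t + 1) * (y (t - 1) \<bullet> (K *v (x t - x (t + 1))) + F (x t) - F (x (t + 1)))"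
    by (simp only: distrib_left)
  with A B show ?thesis by linarith
qed

text \<open>
  By the optimality of \<open>w t\<close> the left-hand side is at most \<open>residual t \<bullet> (v - y t)\<close>, and the residual is
  the sum of \<open>\<mu> *\<^sub>R y t\<close> and the dual proximal term; each part is expanded by the three-point identity.
\<close>

lemma dual_step:
  assumes t: "t \<ge> 1"
  shows "G (w t) - G ws + residual t \<bullet> v - y t \<bullet> (K *v (x t - xs))
    \<le> \<mu> / 2 * ((norm v)\<^sup>2 - (norm (v - y t))\<^sup>2)
      + \<tau> t / 2 * ((norm (v - y (t - 1)))\<^sup>2 - (norm (v - y t))\<^sup>2 - (norm (y t - y (t - 1)))\<^sup>2)"
proof -
  have "residual t = K *v (x t - xs) - B *v (w t - ws)"
    using feasible by (simp add: matrix_vector_mult_diff_distrib algebra_simps)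
  then have "y t \<bullet> residual t = y t \<bullet> (K *v (x t - xs)) + y t \<bullet> (B *v (ws - w t))"
    by (simp add: matrix_vector_mult_diff_distrib inner_simps)
  then have "G (w t) - G ws + residual t \<bullet> v - y t \<bullet> (K *v (x t - xs)) \<le> residual t \<bullet> (v - y t)"
    using w_optimality[OF ws, of t] by (simp add: inner_diff_right inner_commute[of "residual t" "y t"])
  also have "\<dots> = \<mu> * (y t \<bullet> (v - y t)) + \<tau> t * ((y t - y (t - 1)) \<bullet> (v - y t))"
    unfolding residual_eq[OF t] by (simp add: inner_add_left)
  also have "y t \<bullet> (v - y t) = ((norm v)\<^sup>2 - (norm (v - y t))\<^sup>2 - (norm (y t))\<^sup>2) / 2"
    using three_point_identity[of 0 "y t" v] by (simp add: norm_minus_commute inner_diff_right)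
  also have "(y t - y (t - 1)) \<bullet> (v - y t)
      = ((norm (v - y (t - 1)))\<^sup>2 - (norm (v - y t))\<^sup>2 - (norm (y t - y (t - 1)))\<^sup>2) / 2"
    using three_point_identity[of "y (t - 1)" "y t" v]
    by (simp add: norm_minus_commute inner_diff_right inner_diff_left)
  also have "\<mu> * (((norm v)\<^sup>2 - (norm (v - y t))\<^sup>2 - (norm (y t))\<^sup>2) / 2)
      \<le> \<mu> / 2 * ((norm v)\<^sup>2 - (norm (v - y t))\<^sup>2)"
    using \<mu> by simp
  finally show ?thesis by simp
qed

text \<open>
  As \<open>(xs, ws)\<close> is feasible, the first part is the Lagrangian gap between \<open>(x t, w t)\<close> with multiplier
  \<open>v\<close> and \<open>(xs, ws)\<close>.  The last summand is the cost of the dual regularization.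
\<close>

definition gap :: "real^'m \<Rightarrow> nat \<Rightarrow> real" where
  "gap v t = F (x t) - F xs + G (w t) - G ws + residual t \<bullet> v - \<mu> / 2 * (norm v)\<^sup>2"

lemma gap_step:
  assumes t: "t \<ge> 1"
  defines "p \<equiv> xb t - x t" and "q \<equiv> x (t + 1) - xb t" and "d \<equiv> y t - y (t - 1)"
    and "r \<equiv> \<eta> (t + 1) / (\<eta> t * (1 - bs t))"
  shows "\<eta> (t + 1) * gap v t
    \<le> ((norm (xb t - xs))\<^sup>2 - (norm (xb (t + 1) - xs))\<^sup>2) / (2 * \<beta>)
      - (1 - \<beta> / 2) * (norm q)\<^sup>2 - r * (p \<bullet> (p + q))
      + \<eta> (t + 1) * L t * norm d * norm (p + q) - \<eta> (t + 1) * \<tau> t / 2 * (norm d)\<^sup>2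
      + \<eta> (t + 1) * \<tau> t / 2 * (norm (v - y (t - 1)))\<^sup>2
      - \<eta> (t + 1) * (\<tau> t + \<mu>) / 2 * (norm (v - y t))\<^sup>2"
proof -
  have e: "0 \<le> \<eta> (t + 1)" using \<eta>_pos[of "t + 1"] by simp
  define P where "P = y t \<bullet> (K *v (x t - xs)) + F (x t) - F xs + d \<bullet> (K *v (p + q))"
  define D where "D = \<mu> / 2 * (- (norm (v - y t))\<^sup>2)
      + \<tau> t / 2 * ((norm (v - y (t - 1)))\<^sup>2 - (norm (v - y t))\<^sup>2 - (norm d)\<^sup>2)"
  have "gap v t - P \<le> D - d \<bullet> (K *v (p + q))"
    using dual_step[OF t, of v] unfolding gap_def P_def D_def d_def right_diff_distrib by simp
  moreover have "- (d \<bullet> (K *v (p + q))) \<le> L t * norm d * norm (p + q)"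
    using cross_term_bound[of t "p + q"] unfolding d_def by linarith
  ultimately have "gap v t \<le> P + D + L t * norm d * norm (p + q)" by simp
  then have "\<eta> (t + 1) * gap v t \<le> \<eta> (t + 1) * (P + D + L t * norm d * norm (p + q))"
    using e by (rule mult_left_mono)
  also have "\<dots> = \<eta> (t + 1) * P + \<eta> (t + 1) * L t * norm d * norm (p + q) + \<eta> (t + 1) * D"
    by (simp add: algebra_simps)
  finally have "\<eta> (t + 1) * gap v t
    \<le> \<eta> (t + 1) * P + \<eta> (t + 1) * L t * norm d * norm (p + q) + \<eta> (t + 1) * D" .
  moreover have "\<eta> (t + 1) * D = \<eta> (t + 1) * \<tau> t / 2 * (norm (v - y (t - 1)))\<^sup>2
      - \<eta> (t + 1) * (\<tau> t + \<mu>) / 2 * (norm (v - y t))\<^sup>2 - \<eta> (t + 1) * \<tau> t / 2 * (norm d)\<^sup>2"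
    unfolding D_def by (simp add: field_simps)
  moreover have "\<eta> (t + 1) * P
    \<le> ((norm (xb t - xs))\<^sup>2 - (norm (xb (t + 1) - xs))\<^sup>2) / (2 * \<beta>)
      - (1 - \<beta> / 2) * (norm q)\<^sup>2 - r * (p \<bullet> (p + q))"
    unfolding P_def p_def q_def d_def r_def using primal_step[OF t] .
  ultimately show ?thesis by linarith
qed

abbreviation rate :: real where
  "rate \<equiv> rate_const \<mu> \<beta> (\<eta> 1) (\<eta> 2) (L 1) xs (x 0) (x 1)"

text \<open>
  What one step leaves to the next: the telescoping primal and dual distances, and the quarter of a square
  from \<open>later_step_quadratic\<close>.
\<close>

definition potential :: "real^'m \<Rightarrow> nat \<Rightarrow> real" where
  "potential v t = (norm (xb (t + 1) - xs))\<^sup>2 / (2 * \<beta>) + (norm (x (t + 1) - xb t))\<^sup>2 / 4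
     + \<eta> (t + 1) * (\<tau> t + \<mu>) / 2 * (norm (v - y t))\<^sup>2"

lemma potential_nonneg: "t \<ge> 1 \<Longrightarrow> 0 \<le> potential v t"
  unfolding potential_def using \<beta> \<eta>_pos[of "t + 1"] \<tau>_nonneg[of t] \<mu>
  by (intro add_nonneg_nonneg mult_nonneg_nonneg divide_nonneg_nonneg) auto

lemma first_gap: "\<eta> 2 * gap v 1 \<le> rate / 2 - potential v 1"
proof -
  define p where "p = xb 1 - x 1"
  define q where "q = x 2 - xb 1"
  define d where "d = y 1 - y 0"
  define \<kappa> where "\<kappa> = \<eta> 2 * (L 1)\<^sup>2 / \<mu>"
  define r where "r = \<eta> 2 / \<eta> 1"
  have xb1: "xb 1 = x 0" using xb_step[of 1] x_init init by simp
  have \<eta>2_pos: "0 < \<eta> 2" using \<eta>_pos[of 2] by simp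
  have step: "\<eta> 2 * gap v 1
    \<le> ((norm (x 0 - xs))\<^sup>2 - (norm (xb 2 - xs))\<^sup>2) / (2 * \<beta>)
      - (1 - \<beta> / 2) * (norm q)\<^sup>2 - r * (p \<bullet> (p + q))
      + \<eta> 2 * L 1 * norm d * norm (p + q)
      - \<eta> 2 * (\<tau> 1 + \<mu>) / 2 * (norm (v - y 1))\<^sup>2"
    using gap_step[of 1 v, unfolded one_add_one]
    unfolding p_def q_def d_def r_def xb1 init(2,3) by simp
  have dp: "norm d \<le> L 1 * norm p / \<mu>"
    unfolding d_def p_def xb1 norm_minus_commute[of "x 0" "x 1"]
    using first_dual_increment \<mu> by (simp add: pos_le_divide_eq mult.commute)
  have "\<eta> 2 * L 1 * norm d * norm (p + q) \<le> \<eta> 2 * L 1 * (L 1 * norm p / \<mu>) * norm (p + q)"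
    using dp \<eta>2_pos L_nonneg[of 1] by (intro mult_right_mono mult_left_mono) auto
  also have "\<dots> = \<kappa> * norm p * norm (p + q)"
    by (simp add: \<kappa>_def power2_eq_square)
  finally have cross: "\<eta> 2 * L 1 * norm d * norm (p + q) \<le> \<kappa> * norm p * norm (p + q)" .
  have r: "0 \<le> r" "2 * r \<le> 3 * (1 - \<beta>)"
  proof -
    show "0 \<le> r" using \<eta>2_pos init by (simp add: r_def)
    have "r \<le> 1 - \<beta>" using \<eta>2(1) init by (simp add: r_def pos_divide_le_eq)
    then show "2 * r \<le> 3 * (1 - \<beta>)" using one_minus_\<beta>(1) unfolding right_diff_distrib by linarith
  qed
  have \<kappa>: "0 \<le> \<kappa>" "\<kappa> \<le> 1 / 4"
    using \<eta>2(2) \<eta>2_pos \<mu> by (auto simp: \<kappa>_def field_simps)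
  have quad: "\<kappa> * norm p * norm (p + q) + (norm q)\<^sup>2 / 4 + r / 4 * (norm p)\<^sup>2
      \<le> (1 - \<beta> / 2) * (norm q)\<^sup>2 + r * (p \<bullet> (p + q)) + 5 / 4 * \<kappa> * (norm p)\<^sup>2"
  proof -
    have "(1 + (1 - \<beta>)) / 2 = 1 - \<beta> / 2" by simp
    with first_step_quadratic[OF r \<kappa>, of p q] show ?thesis by (simp only:)
  qed
  have "rate / 2 = (norm (x 0 - xs))\<^sup>2 / (2 * \<beta>) + 5 / 4 * \<kappa> * (norm p)\<^sup>2 - r / 4 * (norm p)\<^sup>2"
    unfolding rate_const_def \<kappa>_def r_def p_def xb1 norm_minus_commute[of "x 1" "x 0"]
    using \<mu> init(1) \<beta>(1) by (simp add: field_simps)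
  moreover have "potential v 1 = (norm (xb 2 - xs))\<^sup>2 / (2 * \<beta>) + (norm q)\<^sup>2 / 4
     + \<eta> 2 * (\<tau> 1 + \<mu>) / 2 * (norm (v - y 1))\<^sup>2"
    unfolding potential_def q_def one_add_one ..
  ultimately show ?thesis using step cross quad by (simp only: diff_divide_distrib)
qed

text \<open>
  The arithmetic-geometric mean inequality splits the cross term between the dual square of weight
  \<open>\<tau> t\<close> and \<open>(norm (p + q))\<^sup>2 / 8\<close>; the factor \<open>1 / 8\<close> comes from the third term
  \<open>\<tau> t / (4 * (L t)\<^sup>2)\<close> of the step size rule.
\<close>

lemma later_gap:
  assumes t: "t \<ge> 2"
  shows "\<eta> (t + 1) * gap v t \<le> potential v (t - 1) - potential v t"
proof -
  have t1: "t \<ge> 1" and idx: "t - 1 + 1 = t" using t by auto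
  define p where "p = xb t - x t"
  define q where "q = x (t + 1) - xb t"
  define d where "d = y t - y (t - 1)"
  define r where "r = \<eta> (t + 1) / (\<eta> t * (1 - bs t))"
  have \<tau>: "0 < \<tau> t" using \<tau>_pos[OF t] .
  have e: "0 < \<eta> (t + 1)" using \<eta>_pos[of "t + 1"] by simp
  have step: "\<eta> (t + 1) * gap v t
    \<le> ((norm (xb t - xs))\<^sup>2 - (norm (xb (t + 1) - xs))\<^sup>2) / (2 * \<beta>)
      - (1 - \<beta> / 2) * (norm q)\<^sup>2 - r * (p \<bullet> (p + q))
      + \<eta> (t + 1) * L t * norm d * norm (p + q) - \<eta> (t + 1) * \<tau> t / 2 * (norm d)\<^sup>2
      + \<eta> (t + 1) * \<tau> t / 2 * (norm (v - y (t - 1)))\<^sup>2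
      - \<eta> (t + 1) * (\<tau> t + \<mu>) / 2 * (norm (v - y t))\<^sup>2"
    using gap_step[OF t1, of v] unfolding p_def q_def d_def r_def .
  have cross: "\<eta> (t + 1) * L t * norm d * norm (p + q)
      \<le> \<eta> (t + 1) * \<tau> t / 2 * (norm d)\<^sup>2 + (norm (p + q))\<^sup>2 / 8"
  proof -
    have "0 \<le> (\<tau> t * norm d - L t * norm (p + q))\<^sup>2" by simp
    then have "2 * \<tau> t * (L t * norm d * norm (p + q))
        \<le> (\<tau> t)\<^sup>2 * (norm d)\<^sup>2 + (L t)\<^sup>2 * (norm (p + q))\<^sup>2"
      by (simp add: power2_diff power_mult_distrib mult_ac)
    then have "\<eta> (t + 1) * (2 * \<tau> t * (L t * norm d * norm (p + q)))
        \<le> \<eta> (t + 1) * ((\<tau> t)\<^sup>2 * (norm d)\<^sup>2 + (L t)\<^sup>2 * (norm (p + q))\<^sup>2)"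
      using e by (intro mult_left_mono) auto
    moreover have "\<eta> (t + 1) * (4 * (L t)\<^sup>2) * (norm (p + q))\<^sup>2 \<le> \<tau> t * (norm (p + q))\<^sup>2"
      using \<eta>_Suc(3)[OF t \<tau>] by (intro mult_right_mono) auto
    ultimately have "2 * \<tau> t * (\<eta> (t + 1) * L t * norm d * norm (p + q))
        \<le> 2 * \<tau> t * (\<eta> (t + 1) * \<tau> t / 2 * (norm d)\<^sup>2 + (norm (p + q))\<^sup>2 / 8)"
      by (simp add: algebra_simps power2_eq_square)
    then show ?thesis using \<tau> by (simp only: mult_le_cancel_left_pos mult_pos_pos zero_less_numeral)
  qed
  have r: "0 \<le> r" "r \<le> 2 * (1 - \<beta>)"
    using \<eta>_ratio[OF t1] e \<eta>_pos[OF t1] bs[OF t] one_minus_\<beta> t by (auto simp: r_def)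
  have quad: "(norm (p + q))\<^sup>2 / 8 + (norm q)\<^sup>2 / 4
      \<le> (1 - \<beta> / 2) * (norm q)\<^sup>2 + r * (p \<bullet> (p + q)) + (norm p)\<^sup>2 / 4"
  proof -
    have "(1 + (1 - \<beta>)) / 2 = 1 - \<beta> / 2" by simp
    with later_step_quadratic[OF r, of p q] show ?thesis by (simp only:)
  qed
  have "p = (1 - \<beta>) *\<^sub>R (xb (t - 1) - x t)"
    unfolding p_def using bs[OF t] by (subst xb_step[OF t1]) (simp add: algebra_simps)
  then have "norm p \<le> norm (x t - xb (t - 1))"
    using one_minus_\<beta> \<beta> by (simp add: norm_minus_commute mult_left_le_one_le)
  then have p: "(norm p)\<^sup>2 \<le> (norm (x t - xb (t - 1)))\<^sup>2" by (intro power_mono) auto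
  have "\<eta> (t + 1) * \<tau> t / 2 * (norm (v - y (t - 1)))\<^sup>2
      \<le> \<eta> t * (\<tau> (t - 1) + \<mu>) / 2 * (norm (v - y (t - 1)))\<^sup>2"
    using \<eta>_\<tau>_mono[OF t] by (intro mult_right_mono divide_right_mono) auto
  moreover have "potential v (t - 1) = (norm (xb t - xs))\<^sup>2 / (2 * \<beta>) + (norm (x t - xb (t - 1)))\<^sup>2 / 4
     + \<eta> t * (\<tau> (t - 1) + \<mu>) / 2 * (norm (v - y (t - 1)))\<^sup>2"
    unfolding potential_def idx ..
  moreover have "potential v t = (norm (xb (t + 1) - xs))\<^sup>2 / (2 * \<beta>) + (norm q)\<^sup>2 / 4
     + \<eta> (t + 1) * (\<tau> t + \<mu>) / 2 * (norm (v - y t))\<^sup>2"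
    unfolding potential_def q_def ..
  ultimately show ?thesis using step cross quad p by (simp only: diff_divide_distrib)
qed

section \<open>Ergodic averages\<close>

lemma sum_gap:
  assumes "k \<ge> 1"
  shows "(\<Sum>t=1..k. \<eta> (t + 1) * gap v t) \<le> rate / 2 - potential v k"
  using assms
proof (induction k rule: nat_induct_at_least)
  case base
  then show ?case using first_gap[of v] by (simp add: numeral_2_eq_2)
next
  case (Suc k)
  have "2 \<le> Suc k" using Suc.hyps by simp
  from later_gap[OF this, of v] Suc show ?case by simp
qed

abbreviation xh :: "nat \<Rightarrow> real^'n" where "xh \<equiv> ergodic_avg \<eta> x"
abbreviation wh :: "nat \<Rightarrow> real^'p" where "wh \<equiv> ergodic_avg \<eta> w"

definition total_step :: "nat \<Rightarrow> real" where
  "total_step k = (\<Sum>t=1..k. \<eta> (t + 1))"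

lemma total_step_pos: "k \<ge> 1 \<Longrightarrow> 0 < total_step k"
  unfolding total_step_def using \<eta>_pos by (intro sum_pos) auto

lemma total_step_scaled_avg:
  fixes z :: "nat \<Rightarrow> 'z::real_vector"
  assumes "k \<ge> 1"
  shows "total_step k *\<^sub>R ergodic_avg \<eta> z k = (\<Sum>t=1..k. \<eta> (t + 1) *\<^sub>R z t)"
  using total_step_pos[OF assms] by (simp add: ergodic_avg_def total_step_def)

lemma ergodic_avg_Jensen:
  fixes z :: "nat \<Rightarrow> 'z::real_vector"
  assumes k: "k \<ge> 1" and f: "convex_on C f" and z: "\<And>t. z t \<in> C"
  shows "ergodic_avg \<eta> z k \<in> C" "total_step k * f (ergodic_avg \<eta> z k) \<le> (\<Sum>t=1..k. \<eta> (t + 1) * f (z t))"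
proof -
  define a where "a t = \<eta> (t + 1) / total_step k" for t
  have T: "0 < total_step k" using total_step_pos[OF k] .
  have a: "sum a {1..k} = 1" "\<And>t. 0 \<le> a t"
    using T \<eta>_pos by (auto simp: a_def total_step_def less_imp_le simp flip: sum_divide_distrib)
  have avg: "ergodic_avg \<eta> z k = (\<Sum>t=1..k. a t *\<^sub>R z t)"
    by (simp add: ergodic_avg_def a_def total_step_def scaleR_sum_right divide_inverse mult.commute)
  have ne: "finite {1..k}" "{1..k} \<noteq> {}" using k by auto
  show "ergodic_avg \<eta> z k \<in> C"
    unfolding avg using convex_on_imp_convex[OF f] ne a z by (intro convex_sum) auto
  have "f (ergodic_avg \<eta> z k) \<le> (\<Sum>t=1..k. a t * f (z t))"
    unfolding avg using ne a z f by (intro convex_on_sum) auto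
  then have "total_step k * f (ergodic_avg \<eta> z k) \<le> total_step k * (\<Sum>t=1..k. a t * f (z t))"
    using T by simp
  also have "\<dots> = (\<Sum>t=1..k. \<eta> (t + 1) * f (z t))"
    using T by (simp add: sum_distrib_left a_def)
  finally show "total_step k * f (ergodic_avg \<eta> z k) \<le> (\<Sum>t=1..k. \<eta> (t + 1) * f (z t))" .
qed

lemma total_step_scaled_residual:
  assumes "k \<ge> 1"
  shows "total_step k *\<^sub>R (K *v xh k - B *v wh k + b) = (\<Sum>t=1..k. \<eta> (t + 1) *\<^sub>R residual t)"
proof -
  have "(\<Sum>t=1..k. \<eta> (t + 1) *\<^sub>R residual t)
    = K *v (\<Sum>t=1..k. \<eta> (t + 1) *\<^sub>R x t) - B *v (\<Sum>t=1..k. \<eta> (t + 1) *\<^sub>R w t) + total_step k *\<^sub>R b"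
    by (simp add: total_step_def scaleR_add_right scaleR_diff_right sum.distrib sum_subtractf
        scaleR_sum_left linear_sum[OF matrix_vector_mul_linear] matrix_vector_mult_scaleR)
  then show ?thesis
    unfolding total_step_scaled_avg[OF assms, symmetric]
    by (simp add: matrix_vector_mult_scaleR scaleR_add_right scaleR_diff_right)
qed

text \<open>
  The positive part of the rate constant appears because \<open>total_step k\<close> will be replaced by a lower
  bound, which increases the quotient only if the numerator is nonnegative.
\<close>

lemma ergodic_gap:
  assumes k: "k \<ge> 1"
  shows "F (xh k) + G (wh k) - F xs - G ws + (K *v xh k - B *v wh k + b) \<bullet> v - \<mu> / 2 * (norm v)\<^sup>2
    \<le> max 0 rate / (2 * total_step k)"
proof -
  have T: "0 < total_step k" using total_step_pos[OF k] .
  define c where "c = - F xs - G ws - \<mu> / 2 * (norm v)\<^sup>2"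
  have "(\<Sum>t=1..k. \<eta> (t + 1) * gap v t)
    = (\<Sum>t=1..k. \<eta> (t + 1) * F (x t)) + (\<Sum>t=1..k. \<eta> (t + 1) * G (w t))
      + (\<Sum>t=1..k. \<eta> (t + 1) *\<^sub>R residual t) \<bullet> v + total_step k * c"
  proof -
    have "\<eta> (t + 1) * gap v t = \<eta> (t + 1) * F (x t) + \<eta> (t + 1) * G (w t)
        + (\<eta> (t + 1) *\<^sub>R residual t) \<bullet> v + \<eta> (t + 1) * c" for t
      unfolding gap_def c_def inner_scaleR_left by (simp add: algebra_simps)
    then show ?thesis
      by (simp only: sum.distrib inner_sum_left total_step_def sum_distrib_right)
  qed
  moreover have "\<dots> = (\<Sum>t=1..k. \<eta> (t + 1) * F (x t)) + (\<Sum>t=1..k. \<eta> (t + 1) * G (w t))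
      + total_step k * ((K *v xh k - B *v wh k + b) \<bullet> v) + total_step k * c"
    unfolding total_step_scaled_residual[OF k, symmetric] by simp
  moreover have "(\<Sum>t=1..k. \<eta> (t + 1) * gap v t) \<le> max 0 rate / 2"
    using sum_gap[OF k, of v] potential_nonneg[OF k, of v] by simp
  ultimately have "total_step k * F (xh k) + total_step k * G (wh k)
      + total_step k * ((K *v xh k - B *v wh k + b) \<bullet> v) + total_step k * c \<le> max 0 rate / 2"
    using ergodic_avg_Jensen(2)[OF k F, of x, OF x_in] ergodic_avg_Jensen(2)[OF k G, of w, OF w_in] by linarith
  then have "(F (xh k) + G (wh k) + (K *v xh k - B *v wh k + b) \<bullet> v + c) * (2 * total_step k) \<le> max 0 rate"
    by (simp add: algebra_simps)
  then have "F (xh k) + G (wh k) + (K *v xh k - B *v wh k + b) \<bullet> v + c \<le> max 0 rate / (2 * total_step k)"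
    using T by (simp only: pos_le_divide_eq zero_less_mult_iff zero_less_numeral simp_thms)
  then show ?thesis by (simp add: c_def)
qed

lemma inverse_total_step_bound:
  assumes k: "k \<ge> 1"
  shows "\<mu> / (2 * total_step k) \<le> 12 * (Lh k)\<^sup>2 / (6 * real k + \<alpha> * real k * (real k - 3))"
  using sum_\<eta>_lower_bound[of k, folded total_step_def] total_step_pos[OF k] rate_denominator_pos[OF k]
  by (simp add: divide_le_eq pos_le_divide_eq mult_ac)

lemma objective_bound:
  assumes k: "k \<ge> 1"
  shows "F (xh k) + G (wh k) - F xs - G ws
    \<le> 12 * (Lh k)\<^sup>2 / (\<mu> * (6 * real k + \<alpha> * real k * (real k - 3))) * max 0 rate"
proof -
  have "F (xh k) + G (wh k) - F xs - G ws \<le> max 0 rate / (2 * total_step k)"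
    using ergodic_gap[OF k, of 0] by simp
  also have "\<dots> = (\<mu> / (2 * total_step k)) / \<mu> * max 0 rate" using \<mu> by simp
  also have "\<dots> \<le> (12 * (Lh k)\<^sup>2 / (6 * real k + \<alpha> * real k * (real k - 3))) / \<mu> * max 0 rate"
    using inverse_total_step_bound[OF k] \<mu> by (intro mult_right_mono divide_right_mono) auto
  finally show ?thesis by (simp add: mult.commute)
qed

text \<open>
  The multiplier \<open>c / \<mu>\<close> maximizes \<open>c \<bullet> v - \<mu> / 2 * (norm v)\<^sup>2\<close>, with value \<open>(norm c)\<^sup>2 / (2 * \<mu>)\<close>.
  The saddle point inequality bounds the objective below by \<open>- (c \<bullet> ys)\<close>.  Together they give a quadratic
  inequality for \<open>norm c\<close>.
\<close>

lemma feasibility_bound: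
  assumes k: "k \<ge> 1"
    and saddle: "\<And>u v. u \<in> X \<Longrightarrow> v \<in> W \<Longrightarrow> F xs + G ws \<le> F u + G v + (K *v u - B *v v + b) \<bullet> ys"
  shows "norm (K *v xh k - B *v wh k + b) \<le> 2 * \<mu> * norm ys
    + 2 * sqrt (12 * (Lh k)\<^sup>2 / (6 * real k + \<alpha> * real k * (real k - 3)) * max 0 rate)"
proof -
  define c where "c = K *v xh k - B *v wh k + b"
  define E where "E = 12 * (Lh k)\<^sup>2 / (6 * real k + \<alpha> * real k * (real k - 3)) * max 0 rate"
  have T: "0 < total_step k" using total_step_pos[OF k] .
  have E: "\<mu> * (max 0 rate / (2 * total_step k)) \<le> E"
  proof -
    have "\<mu> * (max 0 rate / (2 * total_step k)) = \<mu> / (2 * total_step k) * max 0 rate" by simp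
    also have "\<dots> \<le> E"
      unfolding E_def using inverse_total_step_bound[OF k] by (intro mult_right_mono) auto
    finally show ?thesis .
  qed
  have E0: "0 \<le> E" unfolding E_def using rate_denominator_pos[OF k] by (intro mult_nonneg_nonneg divide_nonneg_pos) auto
  have "0 \<le> F (xh k) + G (wh k) - F xs - G ws + c \<bullet> ys"
    using saddle[OF ergodic_avg_Jensen(1)[OF k F, of x, OF x_in] ergodic_avg_Jensen(1)[OF k G, of w, OF w_in]]
    by (simp add: c_def)
  moreover have "c \<bullet> ys \<le> norm c * norm ys" by (rule norm_cauchy_schwarz)
  moreover have "F (xh k) + G (wh k) - F xs - G ws + (norm c)\<^sup>2 / (2 * \<mu>) \<le> max 0 rate / (2 * total_step k)"
  proof -
    have "c \<bullet> (c /\<^sub>R \<mu>) - \<mu> / 2 * (norm (c /\<^sub>R \<mu>))\<^sup>2 = (norm c)\<^sup>2 / (2 * \<mu>)"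
      using \<mu> by (simp add: power_mult_distrib power2_norm_eq_inner[symmetric] power_divide field_simps
          power2_eq_square)
    with ergodic_gap[OF k, of "c /\<^sub>R \<mu>"] show ?thesis unfolding c_def[symmetric] by linarith
  qed
  ultimately have "(norm c)\<^sup>2 / (2 * \<mu>) \<le> max 0 rate / (2 * total_step k) + norm c * norm ys" by linarith
  then have "\<mu> * ((norm c)\<^sup>2 / (2 * \<mu>)) \<le> \<mu> * (max 0 rate / (2 * total_step k) + norm c * norm ys)"
    using \<mu> by (intro mult_left_mono) auto
  moreover have "\<mu> * ((norm c)\<^sup>2 / (2 * \<mu>)) = (norm c)\<^sup>2 / 2" using \<mu> by simp
  ultimately have "(norm c)\<^sup>2 \<le> 2 * E + 2 * \<mu> * norm ys * norm c"
    using E by (simp add: distrib_left mult_ac)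
  then have c2: "(norm c - 2 * \<mu> * norm ys) * norm c \<le> 4 * E"
    using E0 by (simp add: power2_eq_square algebra_simps)
  have "norm c - 2 * \<mu> * norm ys \<le> sqrt (4 * E)"
  proof (cases "norm c - 2 * \<mu> * norm ys \<le> 0")
    case True
    then show ?thesis using E0 by (smt (verit) real_sqrt_ge_zero)
  next
    case False
    have "(norm c - 2 * \<mu> * norm ys)\<^sup>2 \<le> (norm c - 2 * \<mu> * norm ys) * norm c"
      unfolding power2_eq_square using False \<mu> by (intro mult_left_mono) auto
    then show ?thesis using c2 by (intro real_le_rsqrt) linarith
  qed
  also have "sqrt (4 * E) = 2 * sqrt E" by (simp add: real_sqrt_mult)
  finally show ?thesis unfolding c_def E_def by simp
qed

end

theorem corollary3p3:
  fixes X :: "(real^'n) set" and W :: "(real^'p) set"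
    and F :: "real^'n \<Rightarrow> real" and G :: "real^'p \<Rightarrow> real"
    and K :: "real^'n^'m" and B :: "real^'p^'m" and b :: "real^'m"
    and xs :: "real^'n" and ws :: "real^'p" and ys :: "real^'m"
    and \<mu> \<alpha> \<beta> :: real and bs \<eta> \<tau> :: "nat \<Rightarrow> real"
    and x xb :: "nat \<Rightarrow> real^'n" and w :: "nat \<Rightarrow> real^'p" and y :: "nat \<Rightarrow> real^'m"
  assumes "X \<noteq> {}" "closed X" "convex X" "W \<noteq> {}" "closed W" "convex W"
    and "convex_on X F" "lsc_on X F" "convex_on W G" "lsc_on W G"
    and "optimal_solution X W F G K B b xs ws"
    and "saddle_point X W F G K B b xs ws ys"
    and "\<mu> > 0" "0 < \<alpha>" "\<alpha> \<le> 1" "0 < \<beta>" "\<beta> \<le> 1 - sqrt 6 / 3"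
    and "ac_admm X W F G K B b \<mu> bs \<eta> \<tau> x xb w y"
    and "step_size_rule \<mu> \<alpha> \<beta> (local_norm K y) bs \<eta> \<tau>"
  shows "let Lh = L_hat \<mu> \<beta> (\<eta> 1) (local_norm K y);
             R = max 0 (rate_const \<mu> \<beta> (\<eta> 1) (\<eta> 2) (local_norm K y 1) xs (x 0) (x 1))
         in
           (\<forall>t\<ge>2. \<eta> t \<ge> (3 + \<alpha> * (real t - 3)) * \<mu> / (12 * (Lh (t - 1))\<^sup>2)) \<and>
           (\<forall>k\<ge>1.
              F (ergodic_avg \<eta> x k) + G (ergodic_avg \<eta> w k) - F xs - G ws
                \<le> 12 * (Lh k)\<^sup>2 / (\<mu> * (6 * real k + \<alpha> * real k * (real k - 3))) * R \<and>
              norm (K *v ergodic_avg \<eta> x k - B *v ergodic_avg \<eta> w k + b)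
                \<le> 2 * \<mu> * norm ys
                    + 2 * sqrt (12 * (Lh k)\<^sup>2 / (6 * real k + \<alpha> * real k * (real k - 3)) * R))"
proof -
  have feasible: "K *v xs - B *v ws + b = 0"
    using \<open>optimal_solution X W F G K B b xs ws\<close>
    by (auto simp: optimal_solution_def is_arg_min_def algebra_simps)
  have xs: "xs \<in> X" and ws: "ws \<in> W"
    using \<open>saddle_point X W F G K B b xs ws ys\<close> by (auto simp: saddle_point_def)
  have saddle: "F xs + G ws \<le> F u + G v + (K *v u - B *v v + b) \<bullet> ys" if "u \<in> X" "v \<in> W" for u v
    using \<open>saddle_point X W F G K B b xs ws ys\<close> that feasible
    by (auto simp: saddle_point_def lagrangian_def)
  interpret ac_admm_run X W F G K B b \<mu> \<alpha> \<beta> bs \<eta> \<tau> x xb w y xs ws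
    using assms feasible xs ws by unfold_locales (auto simp: local_norm_def)
  show ?thesis
    unfolding Let_def using \<eta>_lower_bound objective_bound feasibility_bound[OF _ saddle] by blast
qed

end
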